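(* Let $p$ be a prime and let $f\colon R\to S$ be a map of $\mathbf{F}_p$-algebras which induces an isomorphism of seminormalizations $R^{\mathrm{sn}}\to S^{\mathrm{sn}}$. Then the induced map $\rho\colon\mathcal{W}\Omega^{\ast}_R\to\mathcal{W}\Omega^{\ast}_S$ of saturated de Rham–Witt complexes is an isomorphism of strict Dieudonné algebras.
   Context: A commutative ring $R$ is seminormal if it is reduced and whenever $x,y\in R$ satisfy $x^2=y^3$ there is $t\in R$ with $x=t^3$ and $y=t^2$. Every commutative ring $R$ admits a universal map $R\to R^{\mathrm{sn}}$ to a seminormal ring, called its seminormalization. Fix a prime $p$. A Dieudonné complex is a cochain complex of abelian groups $(M^{\ast},d)$ with a map of graded abelian groups $F\colon M^{\ast}\to M^{\ast}$ satisfying $dF=pFd$. It is saturated if it is $p$-torsion-free and for all $n$, $F$ induces an isomorphism $M^n\to\{x\in M^n:dx\in pM^{n+1}\}$; then the Verschiebung $V$ is the unique map with $F(Vx)=px$. For saturated $M^{\ast}$ put $\mathcal{W}_r(M)^{\ast}=M^{\ast}/(\mathrm{im}(V^r)+\mathrm{im}(dV^r))$ and $\mathcal{W}(M)^{\ast}=\varprojlim_r\mathcal{W}_r(M)^{\ast}$. $M^{\ast}$ is strict if it is saturated and $M^{\ast}\to\mathcal{W}(M)^{\ast}$ is an isomorphism. A Dieudonné algebra is a commutative differential graded algebra $(A^{\ast},d)$ (graded-commutative, $x^2=0$ for homogeneous $x$ of odd degree, $d$ satisfying the Leibniz rule) with a graded ring homomorphism $F$ such that $dF=pFd$, $A^n=0$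 for $n<0$, and $Fx\equiv x^p\pmod p$ for $x\in A^0$; morphisms are graded ring homomorphisms commuting with $d$ and $F$; it is strict if its underlying Dieudonné complex is. For an $\mathbf{F}_p$-algebra $R$, the saturated de Rham–Witt complex $\mathcal{W}\Omega^{\ast}_R$ is the strict Dieudonné algebra with a ring homomorphism $R\to\mathcal{W}\Omega^0_R/V\mathcal{W}\Omega^0_R$ such that for every strict Dieudonné algebra $B^{\ast}$ composition induces a bijection from morphisms $\mathcal{W}\Omega^{\ast}_R\to B^{\ast}$ to ring homomorphisms $R\to B^0/VB^0$. It exists for every $R$, is unique up to unique isomorphism, and is functorial in $R$. *)

theory Defs
  imports "HOL-Computational_Algebra.Primes" "HOL-Algebra.QuotRing"
begin

section \<open>Seminormal rings and seminormalizations\<close>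

definition Fp_algebra :: "nat \<Rightarrow> ('a, 'm) ring_scheme \<Rightarrow> bool" where
  "Fp_algebra p R \<longleftrightarrow> cring R \<and> [p] \<cdot>\<^bsub>R\<^esub> \<one>\<^bsub>R\<^esub> = \<zero>\<^bsub>R\<^esub>"

locale seminormal = cring +
  assumes reduced: "x \<in> carrier R \<Longrightarrow> x [^] (n::nat) = \<zero> \<Longrightarrow> x = \<zero>"
    and square_cube: "x \<in> carrier R \<Longrightarrow> y \<in> carrier R \<Longrightarrow> x [^] (2::nat) = y [^] (3::nat)
      \<Longrightarrow> \<exists>t\<in>carrier R. x = t [^] (3::nat) \<and> y = t [^] (2::nat)"

text \<open>Ring homomorphisms made extensional, so that equality of elements of this set is equality
  on the carrier.\<close>

definition ring_homs :: "('a, 'm) ring_scheme \<Rightarrow> ('b, 'n) ring_scheme \<Rightarrow> ('a \<Rightarrow> 'b) set" where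
  "ring_homs R T = ring_hom R T \<inter> extensional (carrier R)"

text \<open>
  Universal properties quantify over all objects carried by subsets of one type \<open>'u\<close>, and the
  universal object lives in that same type: \<open>'u\<close> plays the role of the universe in which the
  category of seminormal rings (or, below, of strict Dieudonne algebras) is formed. As
  \<open>'u\<close> is a free type variable it can be taken as large as desired.
\<close>

definition seminormalization ::
    "('a, 'm) ring_scheme \<Rightarrow> 'u ring \<Rightarrow> ('a \<Rightarrow> 'u) \<Rightarrow> bool" where
  "seminormalization R Rsn i \<longleftrightarrow>
     cring R \<and> seminormal Rsn \<and> i \<in> ring_hom R Rsn \<and>
     (\<forall>T :: 'u ring. seminormal T \<longrightarrow>
        bij_betw (\<lambda>g. compose (carrier R) g i) (ring_homs Rsn T) (ring_homs R T))"

definition seminormalization_map ::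
    "('a, 'm) ring_scheme \<Rightarrow> 'u ring \<Rightarrow> ('a \<Rightarrow> 'u) \<Rightarrow> 'u ring \<Rightarrow> ('b \<Rightarrow> 'u) \<Rightarrow> ('a \<Rightarrow> 'b) \<Rightarrow> 'u \<Rightarrow> 'u" where
  "seminormalization_map R Rsn i Ssn j f =
     (THE g. g \<in> ring_homs Rsn Ssn \<and> (\<forall>x\<in>carrier R. g (i x) = j (f x)))"


section \<open>Dieudonne complexes\<close>

text \<open>
  As for the modules of HOL-Algebra, the abelian group \<open>gr M n\<close> in degree \<open>n\<close> is a ring record of
  which only \<open>carrier\<close>, \<open>zero\<close> and \<open>add\<close> are relevant.
\<close>

record 'a cochain =
  gr :: "int \<Rightarrow> 'a ring"
  dif :: "int \<Rightarrow> 'a \<Rightarrow> 'a"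

record 'a dieudonne = "'a cochain" +
  frob :: "int \<Rightarrow> 'a \<Rightarrow> 'a"

locale cochain_complex =
  fixes M :: "('a, 'm) cochain_scheme"
  assumes gr_abelian_group: "abelian_group (gr M n)"
    and dif_hom: "dif M n \<in> hom (add_monoid (gr M n)) (add_monoid (gr M (n + 1)))"
    and dif_dif: "x \<in> carrier (gr M n) \<Longrightarrow> dif M (n + 1) (dif M n x) = \<zero>\<^bsub>gr M (n + 2)\<^esub>"

locale dieudonne_complex = cochain_complex M
  for p :: nat and M :: "('a, 'm) dieudonne_scheme" +
  assumes frob_hom: "frob M n \<in> hom (add_monoid (gr M n)) (add_monoid (gr M n))"
    and dif_frob: "x \<in> carrier (gr M n) \<Longrightarrow>
      dif M n (frob M n x) = [p] \<cdot>\<^bsub>gr M (n + 1)\<^esub> frob M (n + 1) (dif M n x)"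

locale saturated_dieudonne_complex = dieudonne_complex p M
  for p :: nat and M :: "('a, 'm) dieudonne_scheme" +
  assumes torsion_free: "x \<in> carrier (gr M n) \<Longrightarrow> [p] \<cdot>\<^bsub>gr M n\<^esub> x = \<zero>\<^bsub>gr M n\<^esub> \<Longrightarrow> x = \<zero>\<^bsub>gr M n\<^esub>"
    and frob_bij: "bij_betw (frob M n) (carrier (gr M n))
      {x \<in> carrier (gr M n). \<exists>y\<in>carrier (gr M (n + 1)). dif M n x = [p] \<cdot>\<^bsub>gr M (n + 1)\<^esub> y}"

definition verschiebung :: "nat \<Rightarrow> ('a, 'm) dieudonne_scheme \<Rightarrow> int \<Rightarrow> 'a \<Rightarrow> 'a" where
  "verschiebung p M n x =
     (THE y. y \<in> carrier (gr M n) \<and> frob M n y = [p] \<cdot>\<^bsub>gr M n\<^esub> x)"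

text \<open>The degree \<open>n\<close> part of \<open>im V^r + im dV^r\<close>.\<close>

definition W_fil :: "nat \<Rightarrow> ('a, 'm) dieudonne_scheme \<Rightarrow> nat \<Rightarrow> int \<Rightarrow> 'a set" where
  "W_fil p M r n =
     (verschiebung p M n ^^ r) ` carrier (gr M n)
     <+>\<^bsub>gr M n\<^esub>
     dif M (n - 1) ` (verschiebung p M (n - 1) ^^ r) ` carrier (gr M (n - 1))"

definition W_trunc :: "nat \<Rightarrow> ('a, 'm) dieudonne_scheme \<Rightarrow> nat \<Rightarrow> 'a set cochain" where
  "W_trunc p M r =
     \<lparr>gr = \<lambda>n. \<lparr>carrier = a_rcosets\<^bsub>gr M n\<^esub> (W_fil p M r n), mult = undefined, one = undefined,
               zero = W_fil p M r n, add = set_add (gr M n)\<rparr>,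
      dif = \<lambda>n C. \<Union>x\<in>C. W_fil p M r (n + 1) +>\<^bsub>gr M (n + 1)\<^esub> dif M n x\<rparr>"

text \<open>The transition map \<open>W_(r+1)(M) \<rightarrow> W_r(M)\<close>.\<close>

definition W_res :: "nat \<Rightarrow> ('a, 'm) dieudonne_scheme \<Rightarrow> nat \<Rightarrow> int \<Rightarrow> 'a set \<Rightarrow> 'a set" where
  "W_res p M r n C = (\<Union>x\<in>C. W_fil p M r n +>\<^bsub>gr M n\<^esub> x)"

definition W_lim :: "nat \<Rightarrow> ('a, 'm) dieudonne_scheme \<Rightarrow> (nat \<Rightarrow> 'a set) cochain" where
  "W_lim p M =
     \<lparr>gr = \<lambda>n. \<lparr>carrier = {X. \<forall>r. X r \<in> carrier (gr (W_trunc p M r) n) \<and>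
                              W_res p M r n (X (Suc r)) = X r},
               mult = undefined, one = undefined,
               zero = \<lambda>r. \<zero>\<^bsub>gr (W_trunc p M r) n\<^esub>,
               add = \<lambda>X Y r. X r \<oplus>\<^bsub>gr (W_trunc p M r) n\<^esub> Y r\<rparr>,
      dif = \<lambda>n X r. dif (W_trunc p M r) n (X r)\<rparr>"

definition cochain_iso ::
    "('a, 'm) cochain_scheme \<Rightarrow> ('b, 'n) cochain_scheme \<Rightarrow> (int \<Rightarrow> 'a \<Rightarrow> 'b) \<Rightarrow> bool" where
  "cochain_iso M N h \<longleftrightarrow>
     (\<forall>n. h n \<in> iso (add_monoid (gr M n)) (add_monoid (gr N n))) \<and>
     (\<forall>n. \<forall>x\<in>carrier (gr M n). h (n + 1) (dif M n x) = dif N n (h n x))"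

locale strict_dieudonne_complex = saturated_dieudonne_complex p M
  for p :: nat and M :: "('a, 'm) dieudonne_scheme" +
  assumes complete: "cochain_iso M (W_lim p M) (\<lambda>n x r. W_fil p M r n +>\<^bsub>gr M n\<^esub> x)"


section \<open>Dieudonne algebras\<close>

record 'a dieudonne_alg = "'a dieudonne" +
  gmul :: "int \<Rightarrow> int \<Rightarrow> 'a \<Rightarrow> 'a \<Rightarrow> 'a"
  gone :: 'a

definition deg0 :: "('a, 'm) dieudonne_alg_scheme \<Rightarrow> 'a ring" where
  "deg0 A = \<lparr>carrier = carrier (gr A 0), mult = gmul A 0 0, one = gone A,
             zero = zero (gr A 0), add = add (gr A 0)\<rparr>"

locale dieudonne_algebra = dieudonne_complex p A
  for p :: nat and A :: "('a, 'm) dieudonne_alg_scheme" +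
  assumes gmul_closed: "x \<in> carrier (gr A i) \<Longrightarrow> y \<in> carrier (gr A j)
      \<Longrightarrow> gmul A i j x y \<in> carrier (gr A (i + j))"
    and gmul_add_left: "x \<in> carrier (gr A i) \<Longrightarrow> x' \<in> carrier (gr A i) \<Longrightarrow> y \<in> carrier (gr A j)
      \<Longrightarrow> gmul A i j (x \<oplus>\<^bsub>gr A i\<^esub> x') y = gmul A i j x y \<oplus>\<^bsub>gr A (i + j)\<^esub> gmul A i j x' y"
    and gmul_add_right: "x \<in> carrier (gr A i) \<Longrightarrow> y \<in> carrier (gr A j) \<Longrightarrow> y' \<in> carrier (gr A j)
      \<Longrightarrow> gmul A i j x (y \<oplus>\<^bsub>gr A j\<^esub> y') = gmul A i j x y \<oplus>\<^bsub>gr A (i + j)\<^esub> gmul A i j x y'"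
    and gmul_assoc: "x \<in> carrier (gr A i) \<Longrightarrow> y \<in> carrier (gr A j) \<Longrightarrow> z \<in> carrier (gr A k)
      \<Longrightarrow> gmul A (i + j) k (gmul A i j x y) z = gmul A i (j + k) x (gmul A j k y z)"
    and gone_closed: "gone A \<in> carrier (gr A 0)"
    and gone_left: "x \<in> carrier (gr A i) \<Longrightarrow> gmul A 0 i (gone A) x = x"
    and gone_right: "x \<in> carrier (gr A i) \<Longrightarrow> gmul A i 0 x (gone A) = x"
    and graded_comm: "x \<in> carrier (gr A i) \<Longrightarrow> y \<in> carrier (gr A j) \<Longrightarrow>
      gmul A i j x y =
        (if odd i \<and> odd j then \<ominus>\<^bsub>gr A (i + j)\<^esub> gmul A j i y x else gmul A j i y x)"
    and odd_square: "odd i \<Longrightarrow> x \<in> carrier (gr A i) \<Longrightarrow> gmul A i i x x = \<zero>\<^bsub>gr A (i + i)\<^esub>"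
    and leibniz: "x \<in> carrier (gr A i) \<Longrightarrow> y \<in> carrier (gr A j) \<Longrightarrow>
      dif A (i + j) (gmul A i j x y) =
        gmul A (i + 1) j (dif A i x) y \<oplus>\<^bsub>gr A (i + j + 1)\<^esub>
        (if odd i then \<ominus>\<^bsub>gr A (i + j + 1)\<^esub> gmul A i (j + 1) x (dif A j y)
         else gmul A i (j + 1) x (dif A j y))"
    and frob_gone: "frob A 0 (gone A) = gone A"
    and frob_gmul: "x \<in> carrier (gr A i) \<Longrightarrow> y \<in> carrier (gr A j)
      \<Longrightarrow> frob A (i + j) (gmul A i j x y) = gmul A i j (frob A i x) (frob A j y)"
    and negative: "n < 0 \<Longrightarrow> carrier (gr A n) = {\<zero>\<^bsub>gr A n\<^esub>}"
    and frob_power: "x \<in> carrier (gr A 0) \<Longrightarrow>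
      \<exists>y\<in>carrier (gr A 0). frob A 0 x = (x [^]\<^bsub>deg0 A\<^esub> p) \<oplus>\<^bsub>gr A 0\<^esub> [p] \<cdot>\<^bsub>gr A 0\<^esub> y"

locale strict_dieudonne_algebra = dieudonne_algebra p A + strict_dieudonne_complex p A
  for p :: nat and A :: "('a, 'm) dieudonne_alg_scheme"

text \<open>Morphisms, extensional in each degree for the same reason as \<open>ring_homs\<close>.\<close>

definition da_mor ::
    "('a, 'm) dieudonne_alg_scheme \<Rightarrow> ('b, 'n) dieudonne_alg_scheme \<Rightarrow> (int \<Rightarrow> 'a \<Rightarrow> 'b) set" where
  "da_mor A B = {h.
     (\<forall>n. h n \<in> hom (add_monoid (gr A n)) (add_monoid (gr B n)) \<inter> extensional (carrier (gr A n))) \<and>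
     h 0 (gone A) = gone B \<and>
     (\<forall>i j. \<forall>x\<in>carrier (gr A i). \<forall>y\<in>carrier (gr A j).
        h (i + j) (gmul A i j x y) = gmul B i j (h i x) (h j y)) \<and>
     (\<forall>n. \<forall>x\<in>carrier (gr A n). h (n + 1) (dif A n x) = dif B n (h n x)) \<and>
     (\<forall>n. \<forall>x\<in>carrier (gr A n). h n (frob A n x) = frob B n (h n x))}"

definition da_iso ::
    "('a, 'm) dieudonne_alg_scheme \<Rightarrow> ('b, 'n) dieudonne_alg_scheme \<Rightarrow> (int \<Rightarrow> 'a \<Rightarrow> 'b) \<Rightarrow> bool" where
  "da_iso A B h \<longleftrightarrow> h \<in> da_mor A B \<and>
     (\<exists>k\<in>da_mor B A. \<forall>n. (\<forall>x\<in>carrier (gr A n). k n (h n x) = x) \<and>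
                           (\<forall>y\<in>carrier (gr B n). h n (k n y) = y))"


section \<open>Saturated de Rham--Witt complexes\<close>

definition V_ideal :: "nat \<Rightarrow> ('a, 'm) dieudonne_alg_scheme \<Rightarrow> 'a set" where
  "V_ideal p A = verschiebung p A 0 ` carrier (gr A 0)"

definition mod_V :: "nat \<Rightarrow> ('a, 'm) dieudonne_alg_scheme \<Rightarrow> 'a set ring" where
  "mod_V p A = deg0 A Quot V_ideal p A"

definition mod_V_map ::
    "nat \<Rightarrow> ('b, 'n) dieudonne_alg_scheme \<Rightarrow> (int \<Rightarrow> 'a \<Rightarrow> 'b) \<Rightarrow> 'a set \<Rightarrow> 'b set" where
  "mod_V_map p B h C = (\<Union>x\<in>C. V_ideal p B +>\<^bsub>deg0 B\<^esub> h 0 x)"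

definition saturated_dRW ::
    "nat \<Rightarrow> ('a, 'm) ring_scheme \<Rightarrow> 'u dieudonne_alg \<Rightarrow> ('a \<Rightarrow> 'u set) \<Rightarrow> bool" where
  "saturated_dRW p R A \<alpha> \<longleftrightarrow>
     Fp_algebra p R \<and> strict_dieudonne_algebra p A \<and> \<alpha> \<in> ring_hom R (mod_V p A) \<and>
     (\<forall>B :: 'u dieudonne_alg. strict_dieudonne_algebra p B \<longrightarrow>
        bij_betw (\<lambda>h. compose (carrier R) (mod_V_map p B h) \<alpha>)
          (da_mor A B) (ring_homs R (mod_V p B)))"

definition saturated_dRW_map ::
    "nat \<Rightarrow> ('a, 'm) ring_scheme \<Rightarrow> 'u dieudonne_alg \<Rightarrow> ('a \<Rightarrow> 'u set) \<Rightarrow>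
     'u dieudonne_alg \<Rightarrow> ('b \<Rightarrow> 'u set) \<Rightarrow> ('a \<Rightarrow> 'b) \<Rightarrow> int \<Rightarrow> 'u \<Rightarrow> 'u" where
  "saturated_dRW_map p R A \<alpha> B \<beta> f =
     (THE h. h \<in> da_mor A B \<and> (\<forall>x\<in>carrier R. mod_V_map p B h (\<alpha> x) = \<beta> (f x)))"

end

theory Submission
  imports Defs "HOL-Algebra.Weak_Morphisms"
begin

text \<open>
  The saturated de Rham--Witt complex of \<open>R\<close> represents the functor sending a strict Dieudonne
  algebra \<open>B\<close> to the set of ring homomorphisms \<open>R \<rightarrow> B^0/VB^0\<close>. The whole content is therefore
  that \<open>Q = A^0/VA^0\<close> is a seminormal ring for each such \<open>A\<close> (theorem \<open>seminormal_mod_V\<close>):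
  homomorphisms from \<open>R\<close> or \<open>S\<close> into a seminormal ring are the same as homomorphisms from the
  seminormalizations, so restriction along \<open>f\<close> is a bijection \<open>Hom(S, Q) \<rightarrow> Hom(R, Q)\<close>
  (\<open>bij_betw_precompose_mod_V\<close>), and the Yoneda argument inverts \<open>\<rho>\<close>.

  Here is why \<open>Q\<close> is seminormal. The map \<open>F\<close> on \<open>A^0\<close> induces \<open>x \<mapsto> x^p\<close> on \<open>Q\<close>, and \<open>Fx \<in> VA^0\<close>
  forces \<open>x \<in> VA^0\<close>; so \<open>x \<mapsto> x^p\<close> is injective on \<open>Q\<close>. Hence \<open>Q\<close> is reduced, and identities in
  \<open>Q\<close> may be checked on \<open>p\<close>-th powers. Now let \<open>x^2 = y^3\<close>. If \<open>p = 2m + 3\<close>, a \<open>t\<close> with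
  \<open>x = t^3\<close> and \<open>y = t^2\<close> satisfies \<open>t^p = x y^m\<close>, and conversely a \<open>p\<close>-th root of \<open>x y^m\<close>
  is such a \<open>t\<close>; if \<open>p = 2\<close>, the same is true of a square root of \<open>y\<close>. It remains to see that these
  elements are \<open>p\<close>-th powers in \<open>Q\<close>.

  The criterion for this is of Cartier type. If \<open>F\<omega>\<close> is exact modulo \<open>VA^1\<close>, then \<open>\<omega>\<close> lies in
  \<open>dVA^0 + VA^1\<close> (\<open>frob_in_exact_plus_V\<close>). Applied to \<open>\<omega> = dx\<close> this says that \<open>dx\<close> equals some \<open>Vz\<close>
  after \<open>x\<close> is changed by an element of \<open>VA^0\<close>; a closed form \<open>Vz\<close> is divisible by \<open>p\<close>, so by
  saturation the changed \<open>x\<close> is in the image of \<open>F\<close>, and its class is a \<open>p\<close>-th power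
  (\<open>frobenius_mod_V_if_frob_dif_in_exact_plus_V\<close>). Writing \<open>Fx = x^p + pc\<close> and dividing
  \<open>dFx = pF(dx)\<close> by \<open>p\<close> gives \<open>F(dx) = x^(p-1) dx + dc\<close>, so it is enough that \<open>x^(p-1) dx\<close> is
  exact modulo \<open>V\<close>.

  For odd \<open>p\<close> and \<open>e = x y^m\<close>, the power \<open>e^(p-1) = (y^(m+1))^p\<close> is itself a \<open>p\<close>-th power in \<open>Q\<close>, and
  \<open>q^p de\<close> is exact modulo \<open>p\<close>, as \<open>d(q^p)\<close> is divisible by \<open>p\<close>. For \<open>p = 2\<close>, differentiating
  \<open>x^2 = y^3\<close> shows that \<open>y^2 dy\<close> vanishes modulo \<open>2\<close> and \<open>dVA^0\<close>. Since \<open>F(y dy)\<close> is \<open>y^3 dy\<close> up to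
  exact forms and multiples of \<open>2\<close>, it is exact modulo \<open>V\<close>; by the Cartier-type statement so is
  \<open>y dy\<close>, which is the criterion for \<open>y\<close>.
\<close>

section \<open>Homomorphisms of abelian groups\<close>

lemma (in abelian_group) minus_eq_iff_eq_add:
  assumes "x \<in> carrier G" "a \<in> carrier G" "b \<in> carrier G"
  shows "x \<ominus> a = b \<longleftrightarrow> x = a \<oplus> b"
proof
  have "a \<oplus> (x \<ominus> a) = x \<oplus> (a \<oplus> \<ominus> a)"
    using assms by (simp add: minus_eq a_lcomm)
  then have "a \<oplus> (x \<ominus> a) = x"
    using assms by (simp add: r_neg)
  then show "x = a \<oplus> b" if "x \<ominus> a = b"
    using that by simp
next
  have "(a \<oplus> b) \<ominus> a = b \<oplus> (a \<oplus> \<ominus> a)"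
    using assms by (simp add: minus_eq a_ac)
  then have "(a \<oplus> b) \<ominus> a = b"
    using assms by (simp add: r_neg)
  then show "x \<ominus> a = b" if "x = a \<oplus> b"
    using that by simp
qed

lemma abelian_group_hom_memI:
  assumes "abelian_group G" "abelian_group H"
    and "\<And>x. x \<in> carrier G \<Longrightarrow> h x \<in> carrier H"
    and "\<And>x y. x \<in> carrier G \<Longrightarrow> y \<in> carrier G \<Longrightarrow> h (x \<oplus>\<^bsub>G\<^esub> y) = h x \<oplus>\<^bsub>H\<^esub> h y"
  shows "abelian_group_hom G H h"
  by (intro abelian_group_homI group_hom.intro group_hom_axioms.intro abelian_group.a_group homI)
    (use assms in simp_all)

lemma abelian_group_hom_add_pow:
  assumes "abelian_group_hom G H h" "x \<in> carrier G"
  shows "h ([(k::nat)] \<cdot>\<^bsub>G\<^esub> x) = [k] \<cdot>\<^bsub>H\<^esub> h x"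
  using group_hom.hom_nat_pow[OF abelian_group_hom.a_group_hom[OF assms(1)], of x k] assms(2)
  by (simp add: add_pow_def)

section \<open>Frobenius and Verschiebung on saturated complexes\<close>

context dieudonne_complex
begin

sublocale gr: abelian_group "gr M n" for n
  by (rule gr_abelian_group)

sublocale dif: abelian_group_hom "gr M n" "gr M (n + 1)" "dif M n" for n
  by (rule abelian_group_homI)
    (simp_all only: gr.abelian_group_axioms gr.a_group dif_hom group_hom_def group_hom_axioms_def)

sublocale frob: abelian_group_hom "gr M n" "gr M n" "frob M n" for n
  by (rule abelian_group_homI)
    (simp_all only: gr.abelian_group_axioms gr.a_group frob_hom group_hom_def group_hom_axioms_def)

lemmas dif_add_pow = abelian_group_hom_add_pow[OF dif.abelian_group_hom_axioms]
lemmas frob_add_pow = abelian_group_hom_add_pow[OF frob.abelian_group_hom_axioms]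

end

context saturated_dieudonne_complex
begin

abbreviation V where "V \<equiv> verschiebung p M"

lemma frob_inject:
  assumes "x \<in> carrier (gr M n)" "y \<in> carrier (gr M n)" "frob M n x = frob M n y"
  shows "x = y"
  by (rule inj_onD[OF bij_betw_imp_inj_on[OF frob_bij] assms(3,1,2)])

lemma p_inject:
  assumes x: "x \<in> carrier (gr M n)" and y: "y \<in> carrier (gr M n)"
    and eq: "[p] \<cdot>\<^bsub>gr M n\<^esub> x = [p] \<cdot>\<^bsub>gr M n\<^esub> y"
  shows "x = y"
proof -
  have "[p] \<cdot>\<^bsub>gr M n\<^esub> (x \<ominus>\<^bsub>gr M n\<^esub> y) = [p] \<cdot>\<^bsub>gr M n\<^esub> x \<ominus>\<^bsub>gr M n\<^esub> [p] \<cdot>\<^bsub>gr M n\<^esub> y"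
    using x y by (simp add: gr.minus_eq gr.add.nat_pow_distrib gr.add.nat_pow_inv)
  also have "\<dots> = \<zero>\<^bsub>gr M n\<^esub>"
    unfolding eq using y by (simp add: gr.minus_eq gr.r_neg)
  finally have "x \<ominus>\<^bsub>gr M n\<^esub> y = \<zero>\<^bsub>gr M n\<^esub>"
    using x y by (simp add: torsion_free)
  then show ?thesis
    using x y by (simp add: gr.minus_eq_iff_eq_add)
qed

lemma in_frob_image:
  assumes "z \<in> carrier (gr M n)" "y \<in> carrier (gr M (n + 1))"
    and "dif M n z = [p] \<cdot>\<^bsub>gr M (n + 1)\<^esub> y"
  obtains x where "x \<in> carrier (gr M n)" "z = frob M n x"
proof -
  have "z \<in> frob M n ` carrier (gr M n)"
    unfolding bij_betw_imp_surj_on[OF frob_bij] using assms by blast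
  with that show thesis by blast
qed

lemma closed_in_frob_image:
  assumes "z \<in> carrier (gr M n)" "dif M n z = \<zero>\<^bsub>gr M (n + 1)\<^esub>"
  obtains x where "x \<in> carrier (gr M n)" "z = frob M n x"
  using in_frob_image[of z n "\<zero>\<^bsub>gr M (n + 1)\<^esub>"] assms by auto

lemma V_eqI:
  assumes "y \<in> carrier (gr M n)" "frob M n y = [p] \<cdot>\<^bsub>gr M n\<^esub> x"
  shows "V n x = y"
  unfolding verschiebung_def
  by (rule the_equality) (use assms frob_inject in auto)

lemma V_closed_frob_V:
  assumes "x \<in> carrier (gr M n)"
  shows "V n x \<in> carrier (gr M n)" and "frob M n (V n x) = [p] \<cdot>\<^bsub>gr M n\<^esub> x"
proof -
  obtain y where "y \<in> carrier (gr M n)" "[p] \<cdot>\<^bsub>gr M n\<^esub> x = frob M n y"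
    by (rule in_frob_image[of "[p] \<cdot>\<^bsub>gr M n\<^esub> x" n "dif M n x"])
      (use assms in \<open>auto simp: dif_add_pow\<close>)
  with V_eqI[of y n x] show "V n x \<in> carrier (gr M n)" "frob M n (V n x) = [p] \<cdot>\<^bsub>gr M n\<^esub> x"
    by auto
qed

lemmas V_closed [simp] = V_closed_frob_V(1)
lemmas frob_V [simp] = V_closed_frob_V(2)

lemma V_frob: "x \<in> carrier (gr M n) \<Longrightarrow> V n (frob M n x) = [p] \<cdot>\<^bsub>gr M n\<^esub> x"
  by (rule V_eqI) (simp_all add: frob_add_pow)

lemma V_add:
  assumes "x \<in> carrier (gr M n)" "y \<in> carrier (gr M n)"
  shows "V n (x \<oplus>\<^bsub>gr M n\<^esub> y) = V n x \<oplus>\<^bsub>gr M n\<^esub> V n y"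
  using assms by (intro V_eqI) (simp_all add: gr.add.nat_pow_distrib)

lemma V_zero: "V n \<zero>\<^bsub>gr M n\<^esub> = \<zero>\<^bsub>gr M n\<^esub>"
  by (rule V_eqI) simp_all

lemma V_minus:
  assumes "x \<in> carrier (gr M n)"
  shows "V n (\<ominus>\<^bsub>gr M n\<^esub> x) = \<ominus>\<^bsub>gr M n\<^esub> V n x"
  using assms by (intro V_eqI) (simp_all add: gr.add.nat_pow_inv)

lemma frob_dif_V:
  assumes "x \<in> carrier (gr M n)"
  shows "frob M (n + 1) (dif M n (V n x)) = dif M n x"
proof (rule p_inject)
  show "[p] \<cdot>\<^bsub>gr M (n + 1)\<^esub> frob M (n + 1) (dif M n (V n x)) = [p] \<cdot>\<^bsub>gr M (n + 1)\<^esub> dif M n x"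
    using assms dif_frob[of "V n x" n] by (simp add: dif_add_pow)
qed (use assms in simp_all)

text \<open>
  If \<open>Fx = Vy\<close>, applying \<open>F\<close> to the differential of both sides gives \<open>dy = pF(F(dx))\<close>, so \<open>y = Fz\<close>
  by saturation and \<open>Fx = VFz = FVz\<close>.
\<close>

lemma in_V_if_frob_in_V:
  assumes x: "x \<in> carrier (gr M n)" and y: "y \<in> carrier (gr M n)" and eq: "frob M n x = V n y"
  obtains z where "z \<in> carrier (gr M n)" "x = V n z"
proof -
  have "dif M n y = frob M (n + 1) (dif M n (frob M n x))"
    using frob_dif_V[OF y] eq by simp
  also have "\<dots> = [p] \<cdot>\<^bsub>gr M (n + 1)\<^esub> frob M (n + 1) (frob M (n + 1) (dif M n x))"
    using x by (simp add: dif_frob frob_add_pow)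
  finally obtain z where z: "z \<in> carrier (gr M n)" "y = frob M n z"
    by (rule in_frob_image[rotated 2]) (use x y in auto)
  have "frob M n x = frob M n (V n z)"
    using eq z by (simp add: V_frob)
  then have "x = V n z"
    by (rule frob_inject[OF x V_closed[OF z(1)]])
  with z that show thesis by blast
qed

text \<open>
  \<open>dVz = 0\<close> implies \<open>dz = FdVz = 0\<close>, hence \<open>z = Fy\<close> and \<open>Vz = VFy = py\<close>.
\<close>

lemma closed_V_is_p_multiple:
  assumes z: "z \<in> carrier (gr M n)" and closed: "dif M n (V n z) = \<zero>\<^bsub>gr M (n + 1)\<^esub>"
  obtains y where "y \<in> carrier (gr M n)" "V n z = [p] \<cdot>\<^bsub>gr M n\<^esub> y"
proof -
  have "dif M n z = \<zero>\<^bsub>gr M (n + 1)\<^esub>"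
    using frob_dif_V[OF z] closed by simp
  then obtain y where "y \<in> carrier (gr M n)" "z = frob M n y"
    using z by (blast elim: closed_in_frob_image)
  then show thesis
    using that V_frob by blast
qed

text \<open>
  The subgroup \<open>dM^n + VM^(n+1)\<close> of \<open>M^(n+1)\<close>; it is indexed by the degree of the primitives.
\<close>

definition exact_plus_V :: "int \<Rightarrow> 'a set" where
  "exact_plus_V n = {dif M n u \<oplus>\<^bsub>gr M (n + 1)\<^esub> V (n + 1) z | u z.
     u \<in> carrier (gr M n) \<and> z \<in> carrier (gr M (n + 1))}"

text \<open>
  This plays the part of the injectivity of the inverse Cartier operator. Because \<open>FdV = d\<close>, replacing
  \<open>w\<close> by \<open>w - dVu\<close> removes the exact part \<open>du\<close> of \<open>Fw\<close>; what remains maps into \<open>VM\<close> under \<open>F\<close>, and so is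
  in \<open>VM\<close> itself.
\<close>

lemma frob_in_exact_plus_V:
  assumes w: "w \<in> carrier (gr M (n + 1))" and "frob M (n + 1) w \<in> exact_plus_V n"
  obtains u z where "u \<in> carrier (gr M n)" "z \<in> carrier (gr M (n + 1))"
    "w = dif M n (V n u) \<oplus>\<^bsub>gr M (n + 1)\<^esub> V (n + 1) z"
proof -
  from assms(2) obtain u z where u: "u \<in> carrier (gr M n)" and z: "z \<in> carrier (gr M (n + 1))"
    and eq: "frob M (n + 1) w = dif M n u \<oplus>\<^bsub>gr M (n + 1)\<^esub> V (n + 1) z"
    unfolding exact_plus_V_def by blast
  let ?w = "w \<ominus>\<^bsub>gr M (n + 1)\<^esub> dif M n (V n u)"
  have "frob M (n + 1) ?w = frob M (n + 1) w \<ominus>\<^bsub>gr M (n + 1)\<^esub> dif M n u"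
    using w u by (simp add: gr.minus_eq frob_dif_V)
  also have "\<dots> = V (n + 1) z"
    using u z by (simp add: eq gr.minus_eq_iff_eq_add)
  finally obtain z' where z': "z' \<in> carrier (gr M (n + 1))" "?w = V (n + 1) z'"
    by (rule in_V_if_frob_in_V[rotated 2]) (use w u z in auto)
  then have "w = dif M n (V n u) \<oplus>\<^bsub>gr M (n + 1)\<^esub> V (n + 1) z'"
    using w u by (subst (asm) gr.minus_eq_iff_eq_add) auto
  with that u z' show thesis by blast
qed

text \<open>
  After subtracting some \<open>Vu\<close> from \<open>x\<close>, the differential is a closed element of the form \<open>Vz\<close>, hence a
  multiple of \<open>p\<close>; saturation then says that \<open>x - Vu\<close> is in the image of \<open>F\<close>.
\<close>

lemma frobenius_mod_V_if_frob_dif_in_exact_plus_V: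
  assumes x: "x \<in> carrier (gr M n)"
    and "frob M (n + 1) (dif M n x) \<in> exact_plus_V n"
  obtains t v where "t \<in> carrier (gr M n)" "v \<in> carrier (gr M n)"
    "x = V n v \<oplus>\<^bsub>gr M n\<^esub> frob M n t"
proof -
  obtain u z where u: "u \<in> carrier (gr M n)" and z: "z \<in> carrier (gr M (n + 1))"
    and eq: "dif M n x = dif M n (V n u) \<oplus>\<^bsub>gr M (n + 1)\<^esub> V (n + 1) z"
    using frob_in_exact_plus_V[OF _ assms(2)] x by auto
  let ?x = "x \<ominus>\<^bsub>gr M n\<^esub> V n u"
  have dx: "dif M n ?x = V (n + 1) z"
    using x u z eq by (simp add: gr.minus_eq flip: gr.minus_eq_iff_eq_add)
  have "dif M (n + 1) (V (n + 1) z) = \<zero>\<^bsub>gr M (n + 1 + 1)\<^esub>"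
    unfolding dx[symmetric] using x u dif_dif[of ?x n] by (simp add: add.assoc)
  with z obtain y where "y \<in> carrier (gr M (n + 1))" "dif M n ?x = [p] \<cdot>\<^bsub>gr M (n + 1)\<^esub> y"
    unfolding dx by (auto elim: closed_V_is_p_multiple)
  with x u obtain t where t: "t \<in> carrier (gr M n)" "?x = frob M n t"
    by (auto elim: in_frob_image[rotated 2])
  then have "x = V n u \<oplus>\<^bsub>gr M n\<^esub> frob M n t"
    using x u by (simp add: gr.minus_eq_iff_eq_add)
  with that t u show thesis by blast
qed

lemma exact_plus_V_closed: "w \<in> exact_plus_V n \<Longrightarrow> w \<in> carrier (gr M (n + 1))"
  by (auto simp: exact_plus_V_def)

lemma dif_in_exact_plus_V: "u \<in> carrier (gr M n) \<Longrightarrow> dif M n u \<in> exact_plus_V n"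
  unfolding exact_plus_V_def
  by (intro CollectI exI[of _ u] exI[of _ "\<zero>\<^bsub>gr M (n + 1)\<^esub>"]) (simp add: V_zero)

lemma V_in_exact_plus_V: "z \<in> carrier (gr M (n + 1)) \<Longrightarrow> V (n + 1) z \<in> exact_plus_V n"
  unfolding exact_plus_V_def
  by (intro CollectI exI[of _ "\<zero>\<^bsub>gr M n\<^esub>"] exI[of _ z]) simp

lemma p_multiple_in_exact_plus_V:
  "z \<in> carrier (gr M (n + 1)) \<Longrightarrow> [p] \<cdot>\<^bsub>gr M (n + 1)\<^esub> z \<in> exact_plus_V n"
  using V_in_exact_plus_V[of "frob M (n + 1) z" n] by (simp add: V_frob)

lemma exact_plus_V_add:
  assumes "w \<in> exact_plus_V n" "w' \<in> exact_plus_V n"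
  shows "w \<oplus>\<^bsub>gr M (n + 1)\<^esub> w' \<in> exact_plus_V n"
proof -
  from assms obtain u z u' z' where
    u: "u \<in> carrier (gr M n)" "u' \<in> carrier (gr M n)" and
    z: "z \<in> carrier (gr M (n + 1))" "z' \<in> carrier (gr M (n + 1))" and
    eq: "w = dif M n u \<oplus>\<^bsub>gr M (n + 1)\<^esub> V (n + 1) z"
        "w' = dif M n u' \<oplus>\<^bsub>gr M (n + 1)\<^esub> V (n + 1) z'"
    unfolding exact_plus_V_def by blast
  have "w \<oplus>\<^bsub>gr M (n + 1)\<^esub> w' =
      dif M n (u \<oplus>\<^bsub>gr M n\<^esub> u') \<oplus>\<^bsub>gr M (n + 1)\<^esub> V (n + 1) (z \<oplus>\<^bsub>gr M (n + 1)\<^esub> z')"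
    using u z by (simp add: eq V_add gr.a_ac)
  with u z show ?thesis
    unfolding exact_plus_V_def by blast
qed

lemma exact_plus_V_minus:
  assumes "w \<in> exact_plus_V n"
  shows "\<ominus>\<^bsub>gr M (n + 1)\<^esub> w \<in> exact_plus_V n"
proof -
  from assms obtain u z where u: "u \<in> carrier (gr M n)" and z: "z \<in> carrier (gr M (n + 1))" and
    eq: "w = dif M n u \<oplus>\<^bsub>gr M (n + 1)\<^esub> V (n + 1) z"
    unfolding exact_plus_V_def by blast
  have "\<ominus>\<^bsub>gr M (n + 1)\<^esub> w =
      dif M n (\<ominus>\<^bsub>gr M n\<^esub> u) \<oplus>\<^bsub>gr M (n + 1)\<^esub> V (n + 1) (\<ominus>\<^bsub>gr M (n + 1)\<^esub> z)"
    using u z by (simp add: eq V_minus gr.minus_add)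
  with u z show ?thesis
    unfolding exact_plus_V_def by blast
qed

lemma exact_plus_V_cancel:
  assumes "w \<oplus>\<^bsub>gr M (n + 1)\<^esub> w' \<in> exact_plus_V n" "w \<in> exact_plus_V n"
    and "w' \<in> carrier (gr M (n + 1))"
  shows "w' \<in> exact_plus_V n"
proof -
  have "w' = \<ominus>\<^bsub>gr M (n + 1)\<^esub> w \<oplus>\<^bsub>gr M (n + 1)\<^esub> (w \<oplus>\<^bsub>gr M (n + 1)\<^esub> w')"
    using exact_plus_V_closed[OF assms(2)] assms(3) by (simp add: gr.r_neg1)
  with assms show ?thesis
    by (metis exact_plus_V_add exact_plus_V_minus)
qed

end

section \<open>The degree zero part of a Dieudonne algebra\<close>

context dieudonne_algebra
begin

lemma gmul_left_hom:
  assumes "x \<in> carrier (gr A i)"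
  shows "abelian_group_hom (gr A j) (gr A (i + j)) (gmul A i j x)"
  by (rule abelian_group_hom_memI[OF gr_abelian_group gr_abelian_group])
    (simp_all add: assms gmul_closed gmul_add_right)

lemma gmul_right_hom:
  assumes "y \<in> carrier (gr A j)"
  shows "abelian_group_hom (gr A i) (gr A (i + j)) (\<lambda>x. gmul A i j x y)"
  by (rule abelian_group_hom_memI[OF gr_abelian_group gr_abelian_group])
    (simp_all add: assms gmul_closed gmul_add_left)

text \<open>
  Sums in degree zero are always written in \<open>gr A 0\<close> and products in \<open>deg0 A\<close>; the rewriting in the
  interpretation below brings the ring laws into this form.
\<close>

lemma cring_deg0: "cring (deg0 A)"
proof (rule cringI)
  show "abelian_group (deg0 A)"
    using gr_abelian_group[of 0] gr.a_comm_group[of 0]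
    by (intro abelian_group.intro abelian_group_axioms.intro abelian_monoid.intro)
      (simp_all add: deg0_def comm_group_def)
  show "comm_monoid (deg0 A)"
  proof (rule comm_monoidI)
    fix x y assume "x \<in> carrier (deg0 A)" "y \<in> carrier (deg0 A)"
    then show "x \<otimes>\<^bsub>deg0 A\<^esub> y = y \<otimes>\<^bsub>deg0 A\<^esub> x"
      using graded_comm[of x 0 y 0] by (simp add: deg0_def)
  qed (use gmul_closed[of _ 0 _ 0] gmul_assoc[of _ 0 _ 0 _ 0] gone_left[of _ 0]
       in \<open>simp_all add: deg0_def gone_closed\<close>)
  show "(x \<oplus>\<^bsub>deg0 A\<^esub> y) \<otimes>\<^bsub>deg0 A\<^esub> z = x \<otimes>\<^bsub>deg0 A\<^esub> z \<oplus>\<^bsub>deg0 A\<^esub> y \<otimes>\<^bsub>deg0 A\<^esub> z"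
    if "x \<in> carrier (deg0 A)" "y \<in> carrier (deg0 A)" "z \<in> carrier (deg0 A)" for x y z
    using that gmul_add_left[of x 0 y z 0] by (simp add: deg0_def)
qed

lemma deg0_simps:
  "carrier (deg0 A) = carrier (gr A 0)" "add (deg0 A) = add (gr A 0)"
  "zero (deg0 A) = zero (gr A 0)" "a_inv (deg0 A) = a_inv (gr A 0)"
  "a_minus (deg0 A) = a_minus (gr A 0)"
  by (simp_all add: deg0_def a_inv_def a_minus_def fun_eq_iff)

sublocale A0: cring "deg0 A"
  rewrites "carrier (deg0 A) = carrier (gr A 0)" and "add (deg0 A) = add (gr A 0)"
    and "zero (deg0 A) = zero (gr A 0)" and "a_inv (deg0 A) = a_inv (gr A 0)"
    and "a_minus (deg0 A) = a_minus (gr A 0)"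
  by (rule cring_deg0) (fact deg0_simps)+

abbreviation act (infixr "\<bullet>" 70) where "act \<equiv> gmul A 0 1"

lemma act_closed [simp]:
  "a \<in> carrier (gr A 0) \<Longrightarrow> w \<in> carrier (gr A 1) \<Longrightarrow> a \<bullet> w \<in> carrier (gr A 1)"
  using gmul_closed[of a 0 w 1] by simp

lemma act_add_left:
  "a \<in> carrier (gr A 0) \<Longrightarrow> b \<in> carrier (gr A 0) \<Longrightarrow> w \<in> carrier (gr A 1) \<Longrightarrow>
    (a \<oplus>\<^bsub>gr A 0\<^esub> b) \<bullet> w = a \<bullet> w \<oplus>\<^bsub>gr A 1\<^esub> b \<bullet> w"
  using gmul_add_left[of a 0 b w 1] by simp

lemma act_add_right:
  "a \<in> carrier (gr A 0) \<Longrightarrow> v \<in> carrier (gr A 1) \<Longrightarrow> w \<in> carrier (gr A 1) \<Longrightarrow>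
    a \<bullet> (v \<oplus>\<^bsub>gr A 1\<^esub> w) = a \<bullet> v \<oplus>\<^bsub>gr A 1\<^esub> a \<bullet> w"
  using gmul_add_right[of a 0 v 1 w] by simp

lemma act_add_pow_left:
  "a \<in> carrier (gr A 0) \<Longrightarrow> w \<in> carrier (gr A 1) \<Longrightarrow>
    ([(k::nat)] \<cdot>\<^bsub>gr A 0\<^esub> a) \<bullet> w = [k] \<cdot>\<^bsub>gr A 1\<^esub> (a \<bullet> w)"
  using abelian_group_hom_add_pow[OF gmul_right_hom[of w 1 0]] by simp

lemma act_add_pow_right:
  "a \<in> carrier (gr A 0) \<Longrightarrow> w \<in> carrier (gr A 1) \<Longrightarrow>
    a \<bullet> ([(k::nat)] \<cdot>\<^bsub>gr A 1\<^esub> w) = [k] \<cdot>\<^bsub>gr A 1\<^esub> (a \<bullet> w)"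
  using abelian_group_hom_add_pow[OF gmul_left_hom[of a 0 1]] by simp

lemma act_mult:
  "a \<in> carrier (gr A 0) \<Longrightarrow> b \<in> carrier (gr A 0) \<Longrightarrow> w \<in> carrier (gr A 1) \<Longrightarrow>
    (a \<otimes>\<^bsub>deg0 A\<^esub> b) \<bullet> w = a \<bullet> b \<bullet> w"
  using gmul_assoc[of a 0 b 0 w 1] by (simp add: deg0_def)

lemma act_one: "w \<in> carrier (gr A 1) \<Longrightarrow> \<one>\<^bsub>deg0 A\<^esub> \<bullet> w = w"
  using gone_left[of w 1] by (simp add: deg0_def)

lemma act_left_commute:
  "a \<in> carrier (gr A 0) \<Longrightarrow> b \<in> carrier (gr A 0) \<Longrightarrow> w \<in> carrier (gr A 1) \<Longrightarrow>
    a \<bullet> b \<bullet> w = b \<bullet> a \<bullet> w"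
  by (metis act_mult A0.m_comm)

lemma dif0_closed [simp]: "x \<in> carrier (gr A 0) \<Longrightarrow> dif A 0 x \<in> carrier (gr A 1)"
  using dif.hom_closed[of x 0] by simp

lemma frob_act:
  "a \<in> carrier (gr A 0) \<Longrightarrow> w \<in> carrier (gr A 1) \<Longrightarrow> frob A 1 (a \<bullet> w) = frob A 0 a \<bullet> frob A 1 w"
  using frob_gmul[of a 0 w 1] by simp

lemma dif_mult:
  "x \<in> carrier (gr A 0) \<Longrightarrow> y \<in> carrier (gr A 0) \<Longrightarrow>
    dif A 0 (x \<otimes>\<^bsub>deg0 A\<^esub> y) = y \<bullet> dif A 0 x \<oplus>\<^bsub>gr A 1\<^esub> x \<bullet> dif A 0 y"
  using leibniz[of x 0 y 0] graded_comm[of "dif A 0 x" 1 y 0] by (simp add: deg0_def)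

lemma dif_power_Suc:
  assumes x: "x \<in> carrier (gr A 0)"
  shows "dif A 0 (x [^]\<^bsub>deg0 A\<^esub> Suc n) = [Suc n] \<cdot>\<^bsub>gr A 1\<^esub> (x [^]\<^bsub>deg0 A\<^esub> n \<bullet> dif A 0 x)"
proof (induction n)
  case 0
  then show ?case using x by (simp add: act_one)
next
  case (Suc n)
  have "dif A 0 (x [^]\<^bsub>deg0 A\<^esub> Suc (Suc n)) =
      x \<bullet> dif A 0 (x [^]\<^bsub>deg0 A\<^esub> Suc n) \<oplus>\<^bsub>gr A 1\<^esub> x [^]\<^bsub>deg0 A\<^esub> Suc n \<bullet> dif A 0 x"
    using x dif_mult[of "x [^]\<^bsub>deg0 A\<^esub> Suc n" x] by simp
  also have "x \<bullet> dif A 0 (x [^]\<^bsub>deg0 A\<^esub> Suc n) =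
      [Suc n] \<cdot>\<^bsub>gr A 1\<^esub> (x [^]\<^bsub>deg0 A\<^esub> Suc n \<bullet> dif A 0 x)"
    unfolding Suc.IH using x
    by (simp del: gr.add.nat_pow_Suc add: act_add_pow_right act_mult act_left_commute[of x])
  finally show ?case
    using x by simp
qed

lemma dif_power:
  "x \<in> carrier (gr A 0) \<Longrightarrow> (n::nat) > 0 \<Longrightarrow>
    dif A 0 (x [^]\<^bsub>deg0 A\<^esub> n) = [n] \<cdot>\<^bsub>gr A 1\<^esub> (x [^]\<^bsub>deg0 A\<^esub> (n - 1) \<bullet> dif A 0 x)"
  using dif_power_Suc[of x "n - 1"] by simp

end

locale saturated_dieudonne_algebra = dieudonne_algebra p A + saturated_dieudonne_complex p A
  for p :: nat and A :: "('a, 'm) dieudonne_alg_scheme"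

sublocale strict_dieudonne_algebra \<subseteq> saturated_dieudonne_algebra ..

context saturated_dieudonne_algebra
begin

lemma V_gmul_right:
  assumes "x \<in> carrier (gr A i)" "y \<in> carrier (gr A j)"
  shows "gmul A i j x (V j y) = V (i + j) (gmul A i j (frob A i x) y)"
  using assms abelian_group_hom_add_pow[OF gmul_left_hom[of "frob A i x" i j], of y p]
  by (intro V_eqI[symmetric]) (simp_all add: gmul_closed frob_gmul)

lemma V_gmul_left:
  assumes "x \<in> carrier (gr A i)" "y \<in> carrier (gr A j)"
  shows "gmul A i j (V i x) y = V (i + j) (gmul A i j x (frob A j y))"
  using assms abelian_group_hom_add_pow[OF gmul_right_hom[of "frob A j y" j i], of x p]
  by (intro V_eqI[symmetric]) (simp_all add: gmul_closed frob_gmul)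

lemma mult_V:
  "x \<in> carrier (gr A 0) \<Longrightarrow> y \<in> carrier (gr A 0) \<Longrightarrow>
    x \<otimes>\<^bsub>deg0 A\<^esub> V 0 y = V 0 (frob A 0 x \<otimes>\<^bsub>deg0 A\<^esub> y)"
  using V_gmul_right[of x 0 y 0] by (simp add: deg0_def)

lemma V_act:
  "a \<in> carrier (gr A 0) \<Longrightarrow> w \<in> carrier (gr A 1) \<Longrightarrow> V 0 a \<bullet> w = V 1 (a \<bullet> frob A 1 w)"
  using V_gmul_left[of a 0 w 1] by simp

section \<open>Forms that are exact modulo Verschiebung\<close>

abbreviation dA_plus_VA where "dA_plus_VA \<equiv> exact_plus_V 0"

lemmas dA_plus_VA_dif = dif_in_exact_plus_V[where n = 0]
lemmas dA_plus_VA_V = V_in_exact_plus_V[where n = 0, simplified]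
lemmas dA_plus_VA_p = p_multiple_in_exact_plus_V[where n = 0, simplified]
lemmas dA_plus_VA_add = exact_plus_V_add[where n = 0, simplified]
lemmas dA_plus_VA_cancel = exact_plus_V_cancel[where n = 0, simplified]

lemma V_act_in_dA_plus_VA: "a \<in> carrier (gr A 0) \<Longrightarrow> w \<in> carrier (gr A 1) \<Longrightarrow> V 0 a \<bullet> w \<in> dA_plus_VA"
  by (simp add: V_act dA_plus_VA_V)

text \<open>
  Integration by parts: \<open>a du + u da = d(au)\<close> is exact.
\<close>

lemma act_dif_in_dA_plus_VA_by_parts:
  assumes "a \<in> carrier (gr A 0)" "u \<in> carrier (gr A 0)" "u \<bullet> dif A 0 a \<in> dA_plus_VA"
  shows "a \<bullet> dif A 0 u \<in> dA_plus_VA"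
  using dA_plus_VA_cancel[of "u \<bullet> dif A 0 a" "a \<bullet> dif A 0 u"] assms dA_plus_VA_dif[of "a \<otimes>\<^bsub>deg0 A\<^esub> u"]
  by (simp add: dif_mult)

lemma act_dif_V_in_dA_plus_VA:
  "a \<in> carrier (gr A 0) \<Longrightarrow> u \<in> carrier (gr A 0) \<Longrightarrow> a \<bullet> dif A 0 (V 0 u) \<in> dA_plus_VA"
  by (rule act_dif_in_dA_plus_VA_by_parts) (simp_all add: V_act_in_dA_plus_VA)

text \<open>
  By parts, this reduces to \<open>u d(a^p)\<close>, which is a multiple of \<open>p = VF\<close>.
\<close>

lemma power_act_dif_in_dA_plus_VA:
  assumes "a \<in> carrier (gr A 0)" "u \<in> carrier (gr A 0)" "p > 0"
  shows "a [^]\<^bsub>deg0 A\<^esub> p \<bullet> dif A 0 u \<in> dA_plus_VA"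
proof (rule act_dif_in_dA_plus_VA_by_parts)
  show "u \<bullet> dif A 0 (a [^]\<^bsub>deg0 A\<^esub> p) \<in> dA_plus_VA"
    using dA_plus_VA_p[of "u \<bullet> a [^]\<^bsub>deg0 A\<^esub> (p - 1) \<bullet> dif A 0 a"] assms
    by (simp add: dif_power act_add_pow_right)
qed (use assms in simp_all)

text \<open>
  The second identity is the differential of the first, divided by \<open>p\<close>.
\<close>

lemma frob_dif:
  assumes x: "x \<in> carrier (gr A 0)" and "p > 0"
  obtains c where "c \<in> carrier (gr A 0)"
    "frob A 0 x = x [^]\<^bsub>deg0 A\<^esub> p \<oplus>\<^bsub>gr A 0\<^esub> [p] \<cdot>\<^bsub>gr A 0\<^esub> c"
    "frob A 1 (dif A 0 x) = x [^]\<^bsub>deg0 A\<^esub> (p - 1) \<bullet> dif A 0 x \<oplus>\<^bsub>gr A 1\<^esub> dif A 0 c"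
proof -
  obtain c where c: "c \<in> carrier (gr A 0)"
    and eq: "frob A 0 x = x [^]\<^bsub>deg0 A\<^esub> p \<oplus>\<^bsub>gr A 0\<^esub> [p] \<cdot>\<^bsub>gr A 0\<^esub> c"
    using frob_power[OF x] by blast
  have "[p] \<cdot>\<^bsub>gr A 1\<^esub> frob A 1 (dif A 0 x) = dif A 0 (frob A 0 x)"
    using dif_frob[OF x] by simp
  also have "\<dots> = dif A 0 (x [^]\<^bsub>deg0 A\<^esub> p) \<oplus>\<^bsub>gr A 1\<^esub> [p] \<cdot>\<^bsub>gr A 1\<^esub> dif A 0 c"
    using x c dif.hom_add[of "x [^]\<^bsub>deg0 A\<^esub> p" 0 "[p] \<cdot>\<^bsub>gr A 0\<^esub> c"] dif_add_pow[of c 0 p] by (simp add: eq)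
  also have "dif A 0 (x [^]\<^bsub>deg0 A\<^esub> p) = [p] \<cdot>\<^bsub>gr A 1\<^esub> (x [^]\<^bsub>deg0 A\<^esub> (p - 1) \<bullet> dif A 0 x)"
    using dif_power[OF x \<open>p > 0\<close>] .
  also have "\<dots> \<oplus>\<^bsub>gr A 1\<^esub> [p] \<cdot>\<^bsub>gr A 1\<^esub> dif A 0 c =
      [p] \<cdot>\<^bsub>gr A 1\<^esub> (x [^]\<^bsub>deg0 A\<^esub> (p - 1) \<bullet> dif A 0 x \<oplus>\<^bsub>gr A 1\<^esub> dif A 0 c)"
    using x c by (simp add: gr.add.nat_pow_distrib)
  finally have "frob A 1 (dif A 0 x) = x [^]\<^bsub>deg0 A\<^esub> (p - 1) \<bullet> dif A 0 x \<oplus>\<^bsub>gr A 1\<^esub> dif A 0 c"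
    by (rule p_inject[rotated 2]) (use x c in simp_all)
  with c eq that show thesis by blast
qed

lemma frobenius_mod_V_if_act_dif_in_dA_plus_VA:
  assumes x: "x \<in> carrier (gr A 0)" and "p > 0"
    and exact: "x [^]\<^bsub>deg0 A\<^esub> (p - 1) \<bullet> dif A 0 x \<in> dA_plus_VA"
  obtains t v where "t \<in> carrier (gr A 0)" "v \<in> carrier (gr A 0)"
    "x = V 0 v \<oplus>\<^bsub>gr A 0\<^esub> frob A 0 t"
proof -
  obtain c where "c \<in> carrier (gr A 0)"
    "frob A 1 (dif A 0 x) = x [^]\<^bsub>deg0 A\<^esub> (p - 1) \<bullet> dif A 0 x \<oplus>\<^bsub>gr A 1\<^esub> dif A 0 c"
    using frob_dif[OF x \<open>p > 0\<close>] by metis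
  then have "frob A (0 + 1) (dif A 0 x) \<in> dA_plus_VA"
    using exact by (simp add: dA_plus_VA_add dA_plus_VA_dif)
  with x that show thesis
    using frobenius_mod_V_if_frob_dif_in_exact_plus_V[of x 0] by blast
qed

lemma frobenius_mod_V_if_power_pred_is_pth_power:
  assumes e: "e \<in> carrier (gr A 0)" and q: "q \<in> carrier (gr A 0)" and z: "z \<in> carrier (gr A 0)"
    and "p > 0" and eq: "e [^]\<^bsub>deg0 A\<^esub> (p - 1) = V 0 z \<oplus>\<^bsub>gr A 0\<^esub> q [^]\<^bsub>deg0 A\<^esub> p"
  obtains t v where "t \<in> carrier (gr A 0)" "v \<in> carrier (gr A 0)"
    "e = V 0 v \<oplus>\<^bsub>gr A 0\<^esub> frob A 0 t"
proof (rule frobenius_mod_V_if_act_dif_in_dA_plus_VA[OF e \<open>p > 0\<close> _ that])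
  show "e [^]\<^bsub>deg0 A\<^esub> (p - 1) \<bullet> dif A 0 e \<in> dA_plus_VA"
    unfolding eq using e q z \<open>p > 0\<close>
    by (simp add: act_add_left dA_plus_VA_add V_act_in_dA_plus_VA power_act_dif_in_dA_plus_VA)
qed

text \<open>
  The case of characteristic two. The exponents are written as successors, so that the rule for the
  differential of a power applies to them.
\<close>

lemma frobenius_mod_V_of_square_eq_cube:
  assumes p: "p = 2" and x: "x \<in> carrier (gr A 0)" and y: "y \<in> carrier (gr A 0)"
    and z: "z \<in> carrier (gr A 0)"
    and eq: "x [^]\<^bsub>deg0 A\<^esub> Suc 1 = V 0 z \<oplus>\<^bsub>gr A 0\<^esub> y [^]\<^bsub>deg0 A\<^esub> Suc 2"
  obtains t v where "t \<in> carrier (gr A 0)" "v \<in> carrier (gr A 0)"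
    "y = V 0 v \<oplus>\<^bsub>gr A 0\<^esub> frob A 0 t"
proof -
  let ?dy = "dif A 0 y" and ?y2 = "y [^]\<^bsub>deg0 A\<^esub> (2::nat)"
  \<comment> \<open>The differential of the hypothesis, multiplied by \<open>y\<close>, shows that \<open>y^3 dy\<close> is exact modulo \<open>V\<close>:
    all other terms are multiples of \<open>2\<close> or of \<open>dVz\<close>.\<close>
  have "dif A 0 (x [^]\<^bsub>deg0 A\<^esub> Suc 1) = dif A 0 (V 0 z) \<oplus>\<^bsub>gr A 1\<^esub> dif A 0 (y [^]\<^bsub>deg0 A\<^esub> Suc 2)"
    unfolding eq using y z dif.hom_add[of "V 0 z" 0 "y [^]\<^bsub>deg0 A\<^esub> Suc 2"] by simp
  then have d: "[p] \<cdot>\<^bsub>gr A 1\<^esub> (x \<bullet> dif A 0 x) =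
      dif A 0 (V 0 z) \<oplus>\<^bsub>gr A 1\<^esub> ([p] \<cdot>\<^bsub>gr A 1\<^esub> (?y2 \<bullet> ?dy) \<oplus>\<^bsub>gr A 1\<^esub> ?y2 \<bullet> ?dy)"
    unfolding dif_power_Suc[OF x] dif_power_Suc[OF y] using x y
    by (simp add: p numeral_2_eq_2)
  have "y \<bullet> ([p] \<cdot>\<^bsub>gr A 1\<^esub> (x \<bullet> dif A 0 x)) \<in> dA_plus_VA"
    using x y dA_plus_VA_p[of "y \<bullet> x \<bullet> dif A 0 x"] by (simp add: act_add_pow_right)
  then have "y \<bullet> dif A 0 (V 0 z) \<oplus>\<^bsub>gr A 1\<^esub>
      ([p] \<cdot>\<^bsub>gr A 1\<^esub> (y \<bullet> ?y2 \<bullet> ?dy) \<oplus>\<^bsub>gr A 1\<^esub> y \<bullet> ?y2 \<bullet> ?dy) \<in> dA_plus_VA"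
    unfolding d using y z by (simp add: act_add_right act_add_pow_right)
  then have "[p] \<cdot>\<^bsub>gr A 1\<^esub> (y \<bullet> ?y2 \<bullet> ?dy) \<oplus>\<^bsub>gr A 1\<^esub> y \<bullet> ?y2 \<bullet> ?dy \<in> dA_plus_VA"
    by (rule dA_plus_VA_cancel) (use y z in \<open>simp_all add: act_dif_V_in_dA_plus_VA\<close>)
  then have y3: "y \<bullet> ?y2 \<bullet> ?dy \<in> dA_plus_VA"
    by (rule dA_plus_VA_cancel) (use y in \<open>simp_all add: dA_plus_VA_p\<close>)

  obtain c where c: "c \<in> carrier (gr A 0)"
    and Fy: "frob A 0 y = ?y2 \<oplus>\<^bsub>gr A 0\<^esub> [p] \<cdot>\<^bsub>gr A 0\<^esub> c"
    and Fdy: "frob A 1 ?dy = y \<bullet> ?dy \<oplus>\<^bsub>gr A 1\<^esub> dif A 0 c"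
    using frob_dif[OF y] y p by auto
  \<comment> \<open>\<open>F(y dy) = (y^2 + 2c)(y dy + dc)\<close>, where \<open>y^2 dc\<close> is covered by \<open>power_act_dif_in_dA_plus_VA\<close>.\<close>
  have "frob A 1 (y \<bullet> ?dy) = frob A 0 y \<bullet> frob A 1 ?dy"
    using y by (simp add: frob_act)
  also have "\<dots> = ?y2 \<bullet> y \<bullet> ?dy \<oplus>\<^bsub>gr A 1\<^esub> ?y2 \<bullet> dif A 0 c \<oplus>\<^bsub>gr A 1\<^esub>
      [p] \<cdot>\<^bsub>gr A 1\<^esub> (c \<bullet> frob A 1 ?dy)"
    unfolding Fy using y c
    by (simp add: act_add_left act_add_pow_left) (simp add: Fdy act_add_right)
  also have "\<dots> \<in> dA_plus_VA"
    using y3 y c power_act_dif_in_dA_plus_VA[of y c] p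
    by (intro dA_plus_VA_add dA_plus_VA_p) (simp_all add: act_left_commute[of ?y2 y])
  finally have "frob A (0 + 1) (y \<bullet> ?dy) \<in> dA_plus_VA"
    by simp
  then obtain u w where "u \<in> carrier (gr A 0)" "w \<in> carrier (gr A (0 + 1))"
    "y \<bullet> ?dy = dif A 0 (V 0 u) \<oplus>\<^bsub>gr A (0 + 1)\<^esub> V (0 + 1) w"
    by (rule frob_in_exact_plus_V[rotated]) (use y in simp_all)
  then have "y \<bullet> ?dy \<in> dA_plus_VA"
    by (simp add: dA_plus_VA_add dA_plus_VA_dif dA_plus_VA_V)
  then show thesis
    using y p by (intro frobenius_mod_V_if_act_dif_in_dA_plus_VA[OF y _ _ that]) simp_all
qed

section \<open>Seminormality of the quotient by Verschiebung\<close>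

abbreviation Q where "Q \<equiv> mod_V p A"
abbreviation cls where "cls x \<equiv> V_ideal p A +>\<^bsub>deg0 A\<^esub> x"

lemma ideal_V_ideal: "ideal (V_ideal p A) (deg0 A)"
proof (rule idealI)
  show "ring (deg0 A)"
    by (rule cring.axioms(1)[OF cring_deg0])
  have "subgroup (V_ideal p A) (add_monoid (gr A 0))"
  proof (rule gr.add.subgroupI)
    show "V_ideal p A \<subseteq> carrier (gr A 0)" "V_ideal p A \<noteq> {}"
      by (auto simp: V_ideal_def)
    show "\<ominus>\<^bsub>gr A 0\<^esub> a \<in> V_ideal p A" if "a \<in> V_ideal p A" for a
      using that by (auto simp: V_ideal_def simp flip: V_minus)
    show "a \<oplus>\<^bsub>gr A 0\<^esub> b \<in> V_ideal p A" if "a \<in> V_ideal p A" "b \<in> V_ideal p A" for a b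
      using that by (auto simp: V_ideal_def simp flip: V_add)
  qed
  then show "subgroup (V_ideal p A) (add_monoid (deg0 A))"
    by (simp add: deg0_simps)
  fix a x assume a: "a \<in> V_ideal p A" and x: "x \<in> carrier (deg0 A)"
  then show "x \<otimes>\<^bsub>deg0 A\<^esub> a \<in> V_ideal p A"
    by (auto simp: V_ideal_def deg0_simps mult_V)
  moreover have "a \<in> carrier (gr A 0)"
    using a by (auto simp: V_ideal_def)
  ultimately show "a \<otimes>\<^bsub>deg0 A\<^esub> x \<in> V_ideal p A"
    using x by (simp add: deg0_simps A0.m_comm[of a])
qed

lemma cring_mod_V: "cring Q"
  unfolding mod_V_def by (rule ideal.quotient_is_cring[OF ideal_V_ideal cring_deg0])

lemma carrier_mod_V: "carrier Q = cls ` carrier (gr A 0)"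
  by (auto simp: mod_V_def FactRing_def A_RCOSETS_def' deg0_simps)

lemma cls_closed [simp]: "x \<in> carrier (gr A 0) \<Longrightarrow> cls x \<in> carrier Q"
  by (simp add: carrier_mod_V)

lemma cls_eq_iff:
  assumes "x \<in> carrier (gr A 0)" "y \<in> carrier (gr A 0)"
  shows "cls x = cls y \<longleftrightarrow> (\<exists>z\<in>carrier (gr A 0). x = V 0 z \<oplus>\<^bsub>gr A 0\<^esub> y)"
proof -
  have "cls x = cls y \<longleftrightarrow> x \<ominus>\<^bsub>gr A 0\<^esub> y \<in> V_ideal p A"
    using ring.quotient_eq_iff_same_a_r_cos[OF cring.axioms(1)[OF cring_deg0] ideal_V_ideal] assms
    by (simp add: deg0_simps)
  also have "\<dots> \<longleftrightarrow> (\<exists>z\<in>carrier (gr A 0). x = y \<oplus>\<^bsub>gr A 0\<^esub> V 0 z)"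
    using assms by (auto simp: V_ideal_def image_iff gr.minus_eq_iff_eq_add)
  finally show ?thesis
    using assms by (simp add: gr.a_comm[of y] cong: bex_cong)
qed

lemma ring_hom_cls: "ring_hom_ring (deg0 A) Q (\<lambda>x. cls x)"
  unfolding mod_V_def by (rule ideal.rcos_ring_hom_ring[OF ideal_V_ideal])

lemma cls_power:
  "x \<in> carrier (gr A 0) \<Longrightarrow> cls (x [^]\<^bsub>deg0 A\<^esub> (n::nat)) = cls x [^]\<^bsub>Q\<^esub> n"
  using ring_hom_ring.hom_nat_pow[OF ring_hom_cls, of x n] by (simp add: deg0_simps)

lemma cls_frob:
  assumes x: "x \<in> carrier (gr A 0)"
  shows "cls (frob A 0 x) = cls x [^]\<^bsub>Q\<^esub> p"
proof -
  obtain c where "c \<in> carrier (gr A 0)"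
    "frob A 0 x = x [^]\<^bsub>deg0 A\<^esub> p \<oplus>\<^bsub>gr A 0\<^esub> [p] \<cdot>\<^bsub>gr A 0\<^esub> c"
    using frob_power[OF x] by blast
  then have "frob A 0 x = V 0 (frob A 0 c) \<oplus>\<^bsub>gr A 0\<^esub> x [^]\<^bsub>deg0 A\<^esub> p" "frob A 0 c \<in> carrier (gr A 0)"
    using x by (simp_all add: V_frob gr.a_comm)
  then have "cls (frob A 0 x) = cls (x [^]\<^bsub>deg0 A\<^esub> p)"
    using x by (subst cls_eq_iff) auto
  then show ?thesis
    using x by (simp add: cls_power)
qed

text \<open>
  The \<open>p\<close>-th power map of the quotient is induced by the additive map \<open>F\<close>, so injectivity can be
  tested on differences, where it is \<open>in_V_if_frob_in_V\<close>.
\<close>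

lemma mod_V_power_p_inject:
  assumes "a \<in> carrier Q" "b \<in> carrier Q" "a [^]\<^bsub>Q\<^esub> p = b [^]\<^bsub>Q\<^esub> p"
  shows "a = b"
proof -
  obtain x y where x: "x \<in> carrier (gr A 0)" "a = cls x" and y: "y \<in> carrier (gr A 0)" "b = cls y"
    using assms(1,2) by (auto simp: carrier_mod_V)
  have "cls (frob A 0 x) = cls (frob A 0 y)"
    using assms(3) x y by (simp add: cls_frob)
  then obtain z where z: "z \<in> carrier (gr A 0)" "frob A 0 x = V 0 z \<oplus>\<^bsub>gr A 0\<^esub> frob A 0 y"
    using x y by (auto simp: cls_eq_iff)
  have "frob A 0 (x \<ominus>\<^bsub>gr A 0\<^esub> y) = frob A 0 x \<ominus>\<^bsub>gr A 0\<^esub> frob A 0 y"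
    using x y by (simp add: gr.minus_eq)
  also have "\<dots> = V 0 z"
    using x y z by (simp add: gr.minus_eq_iff_eq_add gr.a_comm)
  finally obtain w where "w \<in> carrier (gr A 0)" "x \<ominus>\<^bsub>gr A 0\<^esub> y = V 0 w"
    by (rule in_V_if_frob_in_V[rotated 2]) (use x y z in auto)
  then have "\<exists>w\<in>carrier (gr A 0). x = V 0 w \<oplus>\<^bsub>gr A 0\<^esub> y"
    using x y by (auto simp: gr.minus_eq_iff_eq_add gr.a_comm)
  then show ?thesis
    using x y by (simp add: cls_eq_iff)
qed

text \<open>
  A nilpotent element is killed by some iterate of the injective map \<open>x \<mapsto> x^p\<close>.
\<close>

lemma mod_V_reduced:
  assumes "p > 1" and x: "x \<in> carrier Q" and "x [^]\<^bsub>Q\<^esub> (n::nat) = \<zero>\<^bsub>Q\<^esub>"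
  shows "x = \<zero>\<^bsub>Q\<^esub>"
proof -
  interpret Q: cring Q by (rule cring_mod_V)
  have "x [^]\<^bsub>Q\<^esub> (p ^ n) = x [^]\<^bsub>Q\<^esub> n \<otimes>\<^bsub>Q\<^esub> x [^]\<^bsub>Q\<^esub> (p ^ n - n)"
    using x less_exp[of n] power_mono[of 2 p n] \<open>p > 1\<close> by (simp add: Q.nat_pow_mult)
  then have "x [^]\<^bsub>Q\<^esub> (p ^ n) = \<zero>\<^bsub>Q\<^esub>"
    using assms x by simp
  moreover have "x [^]\<^bsub>Q\<^esub> (p ^ k) = \<zero>\<^bsub>Q\<^esub> \<Longrightarrow> x = \<zero>\<^bsub>Q\<^esub>" for k
  proof (induction k)
    case (Suc k)
    have "(x [^]\<^bsub>Q\<^esub> (p ^ k)) [^]\<^bsub>Q\<^esub> p = \<zero>\<^bsub>Q\<^esub> [^]\<^bsub>Q\<^esub> p"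
      using Suc.prems x \<open>p > 1\<close> by (simp add: Q.nat_pow_pow mult.commute Q.nat_pow_zero)
    then have "x [^]\<^bsub>Q\<^esub> (p ^ k) = \<zero>\<^bsub>Q\<^esub>"
      by (rule mod_V_power_p_inject[rotated 2]) (use x in simp_all)
    then show ?case by (rule Suc.IH)
  qed (use x in simp)
  ultimately show ?thesis by blast
qed

lemma mod_V_pth_root_if_power_pred_is_pth_power:
  assumes "p > 0" and "e \<in> carrier Q" "q \<in> carrier Q" "e [^]\<^bsub>Q\<^esub> (p - 1) = q [^]\<^bsub>Q\<^esub> p"
  obtains t where "t \<in> carrier Q" "e = t [^]\<^bsub>Q\<^esub> p"
proof -
  obtain x y where x: "x \<in> carrier (gr A 0)" "e = cls x" and y: "y \<in> carrier (gr A 0)" "q = cls y"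
    using assms(2,3) by (auto simp: carrier_mod_V)
  have "cls (x [^]\<^bsub>deg0 A\<^esub> (p - 1)) = cls (y [^]\<^bsub>deg0 A\<^esub> p)"
    using x y assms by (simp add: cls_power)
  then obtain z where "z \<in> carrier (gr A 0)"
    "x [^]\<^bsub>deg0 A\<^esub> (p - 1) = V 0 z \<oplus>\<^bsub>gr A 0\<^esub> y [^]\<^bsub>deg0 A\<^esub> p"
    using x y by (auto simp: cls_eq_iff)
  then obtain t v where tv: "t \<in> carrier (gr A 0)" "v \<in> carrier (gr A 0)"
    "x = V 0 v \<oplus>\<^bsub>gr A 0\<^esub> frob A 0 t"
    using frobenius_mod_V_if_power_pred_is_pth_power x(1) y(1) \<open>p > 0\<close> by metis
  then have "cls x = cls (frob A 0 t)"
    using x by (auto simp: cls_eq_iff)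
  with tv x that[of "cls t"] show thesis
    by (simp add: cls_frob)
qed

lemma mod_V_square_root_if_square_eq_cube:
  assumes "p = 2" and "a \<in> carrier Q" "b \<in> carrier Q"
    and eq: "a [^]\<^bsub>Q\<^esub> (2::nat) = b [^]\<^bsub>Q\<^esub> (3::nat)"
  obtains t where "t \<in> carrier Q" "b = t [^]\<^bsub>Q\<^esub> (2::nat)"
proof -
  obtain x y where x: "x \<in> carrier (gr A 0)" "a = cls x" and y: "y \<in> carrier (gr A 0)" "b = cls y"
    using assms(2,3) by (auto simp: carrier_mod_V)
  have "Suc 1 = 2" "Suc 2 = 3" by simp_all
  then have "cls (x [^]\<^bsub>deg0 A\<^esub> Suc 1) = cls (y [^]\<^bsub>deg0 A\<^esub> Suc 2)"
    using x y eq by (simp only: cls_power)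
  then obtain z where "z \<in> carrier (gr A 0)"
    "x [^]\<^bsub>deg0 A\<^esub> Suc 1 = V 0 z \<oplus>\<^bsub>gr A 0\<^esub> y [^]\<^bsub>deg0 A\<^esub> Suc 2"
    using x y by (auto simp: cls_eq_iff simp del: A0.nat_pow_Suc)
  then obtain t v where tv: "t \<in> carrier (gr A 0)" "v \<in> carrier (gr A 0)"
    "y = V 0 v \<oplus>\<^bsub>gr A 0\<^esub> frob A 0 t"
    using frobenius_mod_V_of_square_eq_cube \<open>p = 2\<close> x(1) y(1) by metis
  then have "cls y = cls (frob A 0 t)"
    using y by (auto simp: cls_eq_iff)
  then have "b = cls t [^]\<^bsub>Q\<^esub> p"
    using cls_frob[OF tv(1)] y(2) by simp
  then have "b = cls t [^]\<^bsub>Q\<^esub> (2::nat)"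
    by (simp add: \<open>p = 2\<close>)
  then show thesis
    by (rule that[OF cls_closed[OF tv(1)]])
qed

text \<open>
  All equations are verified after raising them to the \<open>p\<close>-th power.
\<close>

theorem seminormal_mod_V:
  assumes "prime p"
  shows "seminormal Q"
proof -
  interpret Q: cring Q by (rule cring_mod_V)
  have "p > 1"
    using assms by (rule prime_gt_1_nat)
  show ?thesis
  proof unfold_locales
    show "x = \<zero>\<^bsub>Q\<^esub>" if "x \<in> carrier Q" "x [^]\<^bsub>Q\<^esub> n = \<zero>\<^bsub>Q\<^esub>" for x and n :: nat
      using mod_V_reduced[OF \<open>p > 1\<close> that] .
    fix x y assume x: "x \<in> carrier Q" and y: "y \<in> carrier Q"
      and eq: "x [^]\<^bsub>Q\<^esub> (2::nat) = y [^]\<^bsub>Q\<^esub> (3::nat)"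
    show "\<exists>t\<in>carrier Q. x = t [^]\<^bsub>Q\<^esub> (3::nat) \<and> y = t [^]\<^bsub>Q\<^esub> (2::nat)"
    proof (cases "p = 2")
      case True
      obtain t where t: "t \<in> carrier Q" "y = t [^]\<^bsub>Q\<^esub> (2::nat)"
        using mod_V_square_root_if_square_eq_cube[OF True x y eq] by blast
      have "x [^]\<^bsub>Q\<^esub> (2::nat) = (t [^]\<^bsub>Q\<^esub> (3::nat)) [^]\<^bsub>Q\<^esub> (2::nat)"
        unfolding eq t(2) using t(1) by (simp add: Q.nat_pow_pow)
      then have "x [^]\<^bsub>Q\<^esub> p = (t [^]\<^bsub>Q\<^esub> (3::nat)) [^]\<^bsub>Q\<^esub> p"
        by (simp add: True)
      then have "x = t [^]\<^bsub>Q\<^esub> (3::nat)"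
        by (rule mod_V_power_p_inject[rotated 2]) (use x t in simp_all)
      with t show ?thesis by blast
    next
      case False
      then have "odd p" "p \<ge> 3"
        using assms \<open>p > 1\<close> primes_dvd_imp_eq[of 2 p] by (auto simp: two_is_prime_nat)
      then obtain m where m: "p = 2 * m + 3"
        by (metis add.assoc le_add_diff_inverse2 oddE odd_add odd_numeral evenE even_add)
      \<comment> \<open>The exponent \<open>m\<close> is chosen such that \<open>e^2 = y^p\<close>, so a \<open>p\<close>-th root \<open>t\<close> of \<open>e\<close> satisfies
        \<open>(t^2)^p = y^p\<close>.\<close>
      define e where "e = x \<otimes>\<^bsub>Q\<^esub> y [^]\<^bsub>Q\<^esub> m"
      have e: "e \<in> carrier Q"
        using x y by (simp add: e_def)
      have "e [^]\<^bsub>Q\<^esub> (2::nat) = y [^]\<^bsub>Q\<^esub> (3 + m * 2)"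
        using x y by (simp add: e_def Q.nat_pow_distrib Q.nat_pow_pow eq Q.nat_pow_mult)
      also have "3 + m * 2 = p"
        using m by simp
      finally have e2: "e [^]\<^bsub>Q\<^esub> (2::nat) = y [^]\<^bsub>Q\<^esub> p" .
      have "p - 1 = 2 * (m + 1)"
        using m by simp
      then have "e [^]\<^bsub>Q\<^esub> (p - 1) = (e [^]\<^bsub>Q\<^esub> (2::nat)) [^]\<^bsub>Q\<^esub> (m + 1)"
        using e by (simp only: Q.nat_pow_pow)
      also have "\<dots> = (y [^]\<^bsub>Q\<^esub> (m + 1)) [^]\<^bsub>Q\<^esub> p"
        unfolding e2 using y by (simp only: Q.nat_pow_pow mult.commute Q.nat_pow_closed)
      finally obtain t where t: "t \<in> carrier Q" "e = t [^]\<^bsub>Q\<^esub> p"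
        by (rule mod_V_pth_root_if_power_pred_is_pth_power[rotated 3]) (use e y \<open>p > 1\<close> in simp_all)
      have "y [^]\<^bsub>Q\<^esub> p = (t [^]\<^bsub>Q\<^esub> (2::nat)) [^]\<^bsub>Q\<^esub> p"
        unfolding e2[symmetric] t(2) using t(1) by (simp add: Q.nat_pow_pow mult.commute)
      then have y_eq: "y = t [^]\<^bsub>Q\<^esub> (2::nat)"
        by (rule mod_V_power_p_inject[rotated 2]) (use y t in simp_all)
      have "x [^]\<^bsub>Q\<^esub> (3 + 2 * m) = x [^]\<^bsub>Q\<^esub> (3::nat) \<otimes>\<^bsub>Q\<^esub> (x [^]\<^bsub>Q\<^esub> (2::nat)) [^]\<^bsub>Q\<^esub> m"
        using x by (simp add: Q.nat_pow_pow Q.nat_pow_mult)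
      also have "3 + 2 * m = p"
        using m by simp
      also have "x [^]\<^bsub>Q\<^esub> (3::nat) \<otimes>\<^bsub>Q\<^esub> (x [^]\<^bsub>Q\<^esub> (2::nat)) [^]\<^bsub>Q\<^esub> m = e [^]\<^bsub>Q\<^esub> (3::nat)"
        unfolding eq e_def using x y by (simp add: Q.nat_pow_distrib Q.nat_pow_pow mult.commute)
      also have "\<dots> = (t [^]\<^bsub>Q\<^esub> (3::nat)) [^]\<^bsub>Q\<^esub> p"
        unfolding t(2) using t(1) by (simp add: Q.nat_pow_pow mult.commute)
      finally have "x = t [^]\<^bsub>Q\<^esub> (3::nat)"
        by (rule mod_V_power_p_inject[rotated 2]) (use x t in simp_all)
      with y_eq t(1) show ?thesis by blast
    qed
  qed
qed

end

section \<open>Maps into seminormal rings\<close>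

text \<open>
  Used for \<open>A^0/VA^0\<close> and its copy on representatives of the cosets.
\<close>

lemma seminormal_ring_iso:
  assumes "seminormal A" "\<phi> \<in> ring_iso A B" "cring B"
  shows "seminormal B"
proof -
  interpret A: seminormal A by fact
  interpret B: cring B by fact
  interpret \<phi>: ring_hom_ring A B \<phi>
    by unfold_locales (use assms(2) in \<open>simp add: ring_iso_def\<close>)
  have bij: "bij_betw \<phi> (carrier A) (carrier B)"
    using assms(2) by (simp add: ring_iso_def)
  have surj: "\<exists>a\<in>carrier A. x = \<phi> a" if "x \<in> carrier B" for x
    using that bij by (auto simp: bij_betw_def)
  have inj: "a = b" if "a \<in> carrier A" "b \<in> carrier A" "\<phi> a = \<phi> b" for a b
    using that bij by (auto simp: bij_betw_def inj_on_def)
  show ?thesis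
  proof unfold_locales
    fix x and n :: nat assume "x \<in> carrier B" "x [^]\<^bsub>B\<^esub> n = \<zero>\<^bsub>B\<^esub>"
    then obtain a where a: "a \<in> carrier A" "x = \<phi> a" "\<phi> (a [^]\<^bsub>A\<^esub> n) = \<phi> \<zero>\<^bsub>A\<^esub>"
      using surj by (metis \<phi>.hom_nat_pow \<phi>.hom_zero)
    then have "a = \<zero>\<^bsub>A\<^esub>"
      by (intro A.reduced[of a n] inj) simp_all
    with a show "x = \<zero>\<^bsub>B\<^esub>" by simp
  next
    fix x y assume "x \<in> carrier B" "y \<in> carrier B" and eq: "x [^]\<^bsub>B\<^esub> (2::nat) = y [^]\<^bsub>B\<^esub> (3::nat)"
    then obtain a b where a: "a \<in> carrier A" "x = \<phi> a" and b: "b \<in> carrier A" "y = \<phi> b"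
      using surj by metis
    have "a [^]\<^bsub>A\<^esub> (2::nat) = b [^]\<^bsub>A\<^esub> (3::nat)"
      using eq a b by (intro inj) (simp_all add: \<phi>.hom_nat_pow)
    then obtain t where "t \<in> carrier A" "a = t [^]\<^bsub>A\<^esub> (3::nat)" "b = t [^]\<^bsub>A\<^esub> (2::nat)"
      using A.square_cube a(1) b(1) by blast
    then show "\<exists>t\<in>carrier B. x = t [^]\<^bsub>B\<^esub> (3::nat) \<and> y = t [^]\<^bsub>B\<^esub> (2::nat)"
      using a b by (intro bexI[of _ "\<phi> t"]) (simp_all add: \<phi>.hom_nat_pow)
  qed
qed

lemma compose_in_ring_homs:
  assumes "ring A" "g \<in> ring_hom B C" "h \<in> ring_hom A B"
  shows "compose (carrier A) g h \<in> ring_homs A C"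
  using ring.ring_hom_restrict[OF assms(1) ring_hom_trans[OF assms(3,2)], of "compose (carrier A) g h"]
  by (auto simp: ring_homs_def compose_eq)

lemma bij_betw_ex1:
  assumes "bij_betw F A B" "b \<in> B"
  shows "\<exists>!a. a \<in> A \<and> F a = b"
  using assms by (auto simp: bij_betw_def dest: inj_onD)

lemma bij_betw_precompose_ring_iso:
  assumes "ring A" "ring B" and \<phi>: "\<phi> \<in> ring_iso A B"
  shows "bij_betw (\<lambda>g. compose (carrier A) g \<phi>) (ring_homs B C) (ring_homs A C)"
proof (rule bij_betwI)
  let ?\<psi> = "inv_into (carrier A) \<phi>"
  have \<psi>: "?\<psi> \<in> ring_iso B A"
    using ring_iso_set_sym[OF assms(1) \<phi>] .
  have bij: "bij_betw \<phi> (carrier A) (carrier B)"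
    using \<phi> by (simp add: ring_iso_def)
  show "(\<lambda>g. compose (carrier A) g \<phi>) \<in> ring_homs B C \<rightarrow> ring_homs A C"
    using assms by (auto simp: ring_iso_def ring_homs_def intro: compose_in_ring_homs[unfolded ring_homs_def, THEN IntD1])
  show "(\<lambda>g. compose (carrier B) g ?\<psi>) \<in> ring_homs A C \<rightarrow> ring_homs B C"
    using assms \<psi> by (auto simp: ring_iso_def ring_homs_def intro: compose_in_ring_homs[unfolded ring_homs_def, THEN IntD1])
  show "compose (carrier B) (compose (carrier A) g \<phi>) ?\<psi> = g" if "g \<in> ring_homs B C" for g
    using that bij
    by (intro extensionalityI[of _ "carrier B"])
      (auto simp: ring_homs_def compose_eq bij_betw_inv_into_right bij_betwE[OF bij_betw_inv_into])
  show "compose (carrier A) (compose (carrier B) g ?\<psi>) \<phi> = g" if "g \<in> ring_homs A C" for g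
    using that bij
    by (intro extensionalityI[of _ "carrier A"])
      (auto simp: ring_homs_def compose_eq bij_betw_inv_into_left bij_betwE)
qed

lemma bij_betw_postcompose_ring_iso:
  assumes "ring A" "ring B" "ring C" and \<phi>: "\<phi> \<in> ring_iso B C"
  shows "bij_betw (\<lambda>g. compose (carrier A) \<phi> g) (ring_homs A B) (ring_homs A C)"
proof (rule bij_betwI)
  let ?\<psi> = "inv_into (carrier B) \<phi>"
  have \<psi>: "?\<psi> \<in> ring_iso C B"
    using ring_iso_set_sym[OF assms(2) \<phi>] .
  have bij: "bij_betw \<phi> (carrier B) (carrier C)"
    using \<phi> by (simp add: ring_iso_def)
  show "(\<lambda>g. compose (carrier A) \<phi> g) \<in> ring_homs A B \<rightarrow> ring_homs A C"
    using assms by (auto simp: ring_iso_def ring_homs_def intro: compose_in_ring_homs[unfolded ring_homs_def, THEN IntD1])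
  show "(\<lambda>g. compose (carrier A) ?\<psi> g) \<in> ring_homs A C \<rightarrow> ring_homs A B"
    using assms \<psi> by (auto simp: ring_iso_def ring_homs_def intro: compose_in_ring_homs[unfolded ring_homs_def, THEN IntD1])
  show "compose (carrier A) ?\<psi> (compose (carrier A) \<phi> g) = g" if "g \<in> ring_homs A B" for g
    using that bij
    by (intro extensionalityI[of _ "carrier A"])
      (auto simp: ring_homs_def compose_eq bij_betw_inv_into_left ring_hom_closed)
  show "compose (carrier A) \<phi> (compose (carrier A) ?\<psi> g) = g" if "g \<in> ring_homs A C" for g
    using that bij
    by (intro extensionalityI[of _ "carrier A"])
      (auto simp: ring_homs_def compose_eq bij_betw_inv_into_right ring_hom_closed)
qed

text \<open>
  In the commutative square formed by restriction along \<open>f\<close>, along the induced map of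
  seminormalizations, and along \<open>i\<close> and \<open>j\<close>, three sides are bijections.
\<close>

lemma bij_betw_precompose_if_seminormalization_iso:
  fixes T :: "'u ring" and Rsn Ssn :: "'u ring"
  assumes f: "f \<in> ring_hom R S"
    and R: "seminormalization R Rsn i" and S: "seminormalization S Ssn j"
    and iso: "seminormalization_map R Rsn i Ssn j f \<in> ring_iso Rsn Ssn"
    and T: "seminormal T"
  shows "bij_betw (\<lambda>g. compose (carrier R) g f) (ring_homs S T) (ring_homs R T)"
proof -
  let ?\<phi> = "seminormalization_map R Rsn i Ssn j f"
  have rings: "ring R" "ring S" "seminormal Rsn" "seminormal Ssn"
    and i: "i \<in> ring_hom R Rsn" and j: "j \<in> ring_hom S Ssn"
    using R S by (simp_all add: seminormalization_def cring.axioms)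
  then have rings': "ring Rsn" "ring Ssn"
    by (simp_all add: seminormal_def cring.axioms)
  have univ_R: "bij_betw (\<lambda>g. compose (carrier R) g i) (ring_homs Rsn U) (ring_homs R U)"
    if "seminormal U" for U :: "'u ring"
    using R that by (simp add: seminormalization_def)
  have univ_S: "bij_betw (\<lambda>g. compose (carrier S) g j) (ring_homs Ssn T) (ring_homs S T)"
    using S T by (simp add: seminormalization_def)

  have jf: "compose (carrier R) j f \<in> ring_homs R Ssn"
    using compose_in_ring_homs[OF rings(1) j f] .
  have compatible: "(\<forall>x\<in>carrier R. g (i x) = j (f x)) \<longleftrightarrow>
      compose (carrier R) g i = compose (carrier R) j f" for g
    by (auto simp: compose_def fun_eq_iff restrict_def)
  have "\<exists>!g. g \<in> ring_homs Rsn Ssn \<and> compose (carrier R) g i = compose (carrier R) j f"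
    by (rule bij_betw_ex1[OF univ_R[OF rings(4)] jf])
  then have "?\<phi> \<in> ring_homs Rsn Ssn \<and> compose (carrier R) ?\<phi> i = compose (carrier R) j f"
    unfolding seminormalization_map_def compatible by (rule theI')
  then have \<phi>: "\<And>x. x \<in> carrier R \<Longrightarrow> ?\<phi> (i x) = j (f x)"
    using compatible by blast

  have "bij_betw ((\<lambda>g. compose (carrier R) g i) \<circ> (\<lambda>g. compose (carrier Rsn) g ?\<phi>))
      (ring_homs Ssn T) (ring_homs R T)"
    by (rule bij_betw_trans[OF bij_betw_precompose_ring_iso[OF rings' iso] univ_R[OF T]])
  also have "(\<lambda>g. compose (carrier R) g i) \<circ> (\<lambda>g. compose (carrier Rsn) g ?\<phi>) =
      (\<lambda>g. compose (carrier R) g f) \<circ> (\<lambda>g. compose (carrier S) g j)"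
    using \<phi> ring_hom_closed[OF i] ring_hom_closed[OF f]
    by (auto simp: compose_def fun_eq_iff restrict_def)
  finally show ?thesis
    using bij_betw_comp_iff[OF univ_S] by blast
qed

context saturated_dieudonne_algebra
begin

text \<open>
  The universal property of a seminormalization tests against rings whose elements have the same type
  as those of the seminormalization itself, while the elements of \<open>A^0/VA^0\<close> are sets. Choosing a
  representative of each coset moves the quotient into the right type.
\<close>

lemma mod_V_iso_ring_of_representatives:
  obtains T :: "'a ring" and \<phi> where "cring T" "\<phi> \<in> ring_iso Q T"
proof -
  define \<phi> :: "'a set \<Rightarrow> 'a" where "\<phi> C = (SOME x. x \<in> carrier (gr A 0) \<and> cls x = C)" for C
  have cls_\<phi>: "cls (\<phi> C) = C" if "C \<in> carrier Q" for C
  proof -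
    have "\<exists>x. x \<in> carrier (gr A 0) \<and> cls x = C"
      using that by (auto simp: carrier_mod_V)
    then show ?thesis
      unfolding \<phi>_def by (rule someI2_ex) blast
  qed
  have inj: "inj_on \<phi> (carrier Q)"
    by (rule inj_on_inverseI[of _ "\<lambda>x. cls x"]) (rule cls_\<phi>)
  show thesis
    using that[OF _ inj_imp_image_ring_iso[OF inj]]
      cring.ring_iso_imp_img_cring[OF cring_mod_V inj_imp_image_ring_iso[OF inj]]
    by (simp add: image_ring_def image_group_def monoid.defs)
qed

end

lemma bij_betw_precompose_mod_V:
  fixes Rsn Ssn :: "'u ring" and A :: "('u, 'm) dieudonne_alg_scheme"
  assumes "saturated_dieudonne_algebra p A" and "prime p" and f: "f \<in> ring_hom R S"
    and R: "seminormalization R Rsn i" and S: "seminormalization S Ssn j"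
    and iso: "seminormalization_map R Rsn i Ssn j f \<in> ring_iso Rsn Ssn"
  shows "bij_betw (\<lambda>g. compose (carrier R) g f) (ring_homs S (mod_V p A)) (ring_homs R (mod_V p A))"
proof -
  interpret saturated_dieudonne_algebra p A by fact
  let ?Q = "mod_V p A"
  have rings: "ring R" "ring S" "ring ?Q"
    using R S cring_mod_V by (simp_all add: seminormalization_def cring.axioms)
  obtain T :: "'u ring" and \<phi> where T: "cring T" and \<phi>: "\<phi> \<in> ring_iso ?Q T"
    by (rule mod_V_iso_ring_of_representatives)
  have "seminormal T"
    by (rule seminormal_ring_iso[OF seminormal_mod_V[OF \<open>prime p\<close>] \<phi> T])
  then have "bij_betw ((\<lambda>g. compose (carrier R) g f) \<circ> (\<lambda>g. compose (carrier S) \<phi> g))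
      (ring_homs S ?Q) (ring_homs R T)"
    using bij_betw_trans[OF bij_betw_postcompose_ring_iso[OF rings(2,3) _ \<phi>]
        bij_betw_precompose_if_seminormalization_iso[OF f R S iso]] T
    by (simp add: cring.axioms)
  also have "(\<lambda>g. compose (carrier R) g f) \<circ> (\<lambda>g. compose (carrier S) \<phi> g) =
      (\<lambda>g. compose (carrier R) \<phi> g) \<circ> (\<lambda>g. compose (carrier R) g f)"
    using ring_hom_closed[OF f] by (auto simp: compose_def fun_eq_iff restrict_def)
  finally have comp: "bij_betw ((\<lambda>g. compose (carrier R) \<phi> g) \<circ> (\<lambda>g. compose (carrier R) g f))
      (ring_homs S ?Q) (ring_homs R T)" .
  have "(\<lambda>g. compose (carrier R) g f) ` ring_homs S ?Q \<subseteq> ring_homs R Q"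
    using compose_in_ring_homs[OF rings(1) _ f] by (auto simp: ring_homs_def)
  moreover have "bij_betw (\<lambda>g. compose (carrier R) \<phi> g) (ring_homs R ?Q) (ring_homs R T)"
    using bij_betw_postcompose_ring_iso[OF rings(1,3) _ \<phi>] T by (simp add: cring.axioms)
  ultimately show ?thesis
    using comp bij_betw_comp_iff2 by blast
qed


section \<open>Functoriality of the quotient by Verschiebung\<close>

lemma da_morD:
  assumes "h \<in> da_mor A B"
  shows "h 0 (gone A) = gone B"
    and "x \<in> carrier (gr A i) \<Longrightarrow> y \<in> carrier (gr A j) \<Longrightarrow>
      h (i + j) (gmul A i j x y) = gmul B i j (h i x) (h j y)"
    and "x \<in> carrier (gr A n) \<Longrightarrow> h (n + 1) (dif A n x) = dif B n (h n x)"
    and "x \<in> carrier (gr A n) \<Longrightarrow> h n (frob A n x) = frob B n (h n x)"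
    and "x \<in> carrier (gr A n) \<Longrightarrow> h n x \<in> carrier (gr B n)"
    and "x \<in> carrier (gr A n) \<Longrightarrow> x' \<in> carrier (gr A n) \<Longrightarrow>
      h n (x \<oplus>\<^bsub>gr A n\<^esub> x') = h n x \<oplus>\<^bsub>gr B n\<^esub> h n x'"
  using assms by (simp_all add: da_mor_def hom_def Pi_def)

definition da_comp ::
    "('a, 'm) dieudonne_alg_scheme \<Rightarrow> (int \<Rightarrow> 'b \<Rightarrow> 'c) \<Rightarrow> (int \<Rightarrow> 'a \<Rightarrow> 'b) \<Rightarrow> int \<Rightarrow> 'a \<Rightarrow> 'c" where
  "da_comp A k h n = compose (carrier (gr A n)) (k n) (h n)"

definition da_id :: "('a, 'm) dieudonne_alg_scheme \<Rightarrow> int \<Rightarrow> 'a \<Rightarrow> 'a" where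
  "da_id A n = (\<lambda>x\<in>carrier (gr A n). x)"

lemma (in dieudonne_algebra) da_comp_in_da_mor:
  assumes "h \<in> da_mor A B" "k \<in> da_mor B C"
  shows "da_comp A k h \<in> da_mor A C"
  using assms[THEN da_morD(1)] assms[THEN da_morD(2)] assms[THEN da_morD(3)]
    assms[THEN da_morD(4)] assms[THEN da_morD(5)] assms[THEN da_morD(6)]
  by (auto simp: da_mor_def da_comp_def compose_eq gone_closed gmul_closed intro!: homI)

lemma (in dieudonne_algebra) da_id_in_da_mor: "da_id A \<in> da_mor A A"
  by (auto simp: da_mor_def da_id_def gone_closed gmul_closed intro!: homI)

locale dieudonne_algebra_mor =
  A: saturated_dieudonne_algebra p A + B: saturated_dieudonne_algebra p B
  for p :: nat and A :: "('a, 'm) dieudonne_alg_scheme" and B :: "('b, 'n) dieudonne_alg_scheme" +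
  fixes h :: "int \<Rightarrow> 'a \<Rightarrow> 'b"
  assumes mor: "h \<in> da_mor A B"
begin

text \<open>
  \<open>V\<close> is characterised by \<open>FV = p\<close>, so a map commuting with \<open>F\<close> commutes with \<open>V\<close>.
\<close>

lemma mor_V:
  assumes x: "x \<in> carrier (gr A n)"
  shows "h n (verschiebung p A n x) = verschiebung p B n (h n x)"
proof (rule B.V_eqI[symmetric])
  have "abelian_group_hom (gr A n) (gr B n) (h n)"
    by (rule abelian_group_hom_memI[OF A.gr_abelian_group B.gr_abelian_group])
      (simp_all add: da_morD[OF mor])
  then show "frob B n (h n (verschiebung p A n x)) = [p] \<cdot>\<^bsub>gr B n\<^esub> h n x"
    using x by (simp add: da_morD(4)[OF mor, symmetric] abelian_group_hom_add_pow)
qed (use x in \<open>simp add: da_morD[OF mor]\<close>)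

lemma mod_V_map_cls:
  assumes x: "x \<in> carrier (gr A 0)"
  shows "mod_V_map p B h (A.cls x) = B.cls (h 0 x)"
proof -
  have eq: "B.cls (h 0 y) = B.cls (h 0 x)" if "y \<in> A.cls x" for y
  proof -
    from that obtain z where "z \<in> carrier (gr A 0)" "y = verschiebung p A 0 z \<oplus>\<^bsub>gr A 0\<^esub> x"
      by (auto simp: a_r_coset_def' V_ideal_def A.deg0_simps)
    then have "h 0 y = verschiebung p B 0 (h 0 z) \<oplus>\<^bsub>gr B 0\<^esub> h 0 x" "h 0 z \<in> carrier (gr B 0)"
      using x by (simp_all add: da_morD[OF mor] mor_V)
    then show ?thesis
      using x by (subst B.cls_eq_iff) (auto simp: da_morD[OF mor])
  qed
  have "verschiebung p A 0 \<zero>\<^bsub>gr A 0\<^esub> \<oplus>\<^bsub>gr A 0\<^esub> x \<in> A.cls x"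
    by (auto simp: a_r_coset_def' V_ideal_def A.deg0_simps)
  then have "A.cls x \<noteq> {}" by blast
  then show ?thesis
    using eq by (auto simp: mod_V_map_def)
qed

end

lemma mod_V_map_comp:
  assumes "saturated_dieudonne_algebra p A" "saturated_dieudonne_algebra p B"
    "saturated_dieudonne_algebra p C" "h \<in> da_mor A B" "k \<in> da_mor B C" "c \<in> carrier (mod_V p A)"
  shows "mod_V_map p C (da_comp A k h) c = mod_V_map p C k (mod_V_map p B h c)"
proof -
  interpret h: dieudonne_algebra_mor p A B h
    using assms by (simp add: dieudonne_algebra_mor_def dieudonne_algebra_mor_axioms_def)
  interpret k: dieudonne_algebra_mor p B C k
    using assms by (simp add: dieudonne_algebra_mor_def dieudonne_algebra_mor_axioms_def)
  interpret kh: dieudonne_algebra_mor p A C "da_comp A k h"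
    using assms h.A.da_comp_in_da_mor
    by (simp add: dieudonne_algebra_mor_def dieudonne_algebra_mor_axioms_def)
  from assms(6) obtain x where "x \<in> carrier (gr A 0)" "c = h.A.cls x"
    by (auto simp: h.A.carrier_mod_V)
  then show ?thesis
    by (simp add: h.mod_V_map_cls k.mod_V_map_cls kh.mod_V_map_cls da_morD(5)[OF assms(4)])
      (simp add: da_comp_def compose_eq)
qed

lemma mod_V_map_id:
  assumes "saturated_dieudonne_algebra p A" "c \<in> carrier (mod_V p A)"
  shows "mod_V_map p A (da_id A) c = c"
proof -
  interpret saturated_dieudonne_algebra p A by fact
  interpret dieudonne_algebra_mor p A A "da_id A"
    using assms da_id_in_da_mor
    by (simp add: dieudonne_algebra_mor_def dieudonne_algebra_mor_axioms_def)
  from assms(2) obtain x where "x \<in> carrier (gr A 0)" "c = cls x"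
    by (auto simp: carrier_mod_V)
  then show ?thesis
    by (simp add: mod_V_map_cls) (simp add: da_id_def)
qed

theorem corollary6p5p2:
  fixes p :: nat
    and R :: "('a, 'm) ring_scheme" and S :: "('b, 'n) ring_scheme" and f :: "'a \<Rightarrow> 'b"
    and Rsn Ssn :: "'u ring" and i :: "'a \<Rightarrow> 'u" and j :: "'b \<Rightarrow> 'u"
    and WR WS :: "'u dieudonne_alg" and \<alpha> :: "'a \<Rightarrow> 'u set" and \<beta> :: "'b \<Rightarrow> 'u set"
  assumes "prime p"
    and "Fp_algebra p R" and "Fp_algebra p S" and "f \<in> ring_hom R S"
    and "seminormalization R Rsn i" and "seminormalization S Ssn j"
    and "seminormalization_map R Rsn i Ssn j f \<in> ring_iso Rsn Ssn"
    and "saturated_dRW p R WR \<alpha>" and "saturated_dRW p S WS \<beta>"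
  shows "da_iso WR WS (saturated_dRW_map p R WR \<alpha> WS \<beta> f)"
proof -
  have WR: "strict_dieudonne_algebra p WR" and WS: "strict_dieudonne_algebra p WS"
    and \<alpha>: "\<alpha> \<in> ring_hom R (mod_V p WR)" and \<beta>: "\<beta> \<in> ring_hom S (mod_V p WS)"
    using assms(8,9) by (simp_all add: saturated_dRW_def)
  interpret WR: strict_dieudonne_algebra p WR by (rule WR)
  interpret WS: strict_dieudonne_algebra p WS by (rule WS)
  have sat: "saturated_dieudonne_algebra p WR" "saturated_dieudonne_algebra p WS"
    by unfold_locales
  have R: "ring R"
    using assms(2) by (simp add: Fp_algebra_def cring.axioms)
  have univ_R: "bij_betw (\<lambda>h. compose (carrier R) (mod_V_map p B h) \<alpha>)
      (da_mor WR B) (ring_homs R (mod_V p B))"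
    if "strict_dieudonne_algebra p B" for B :: "'u dieudonne_alg"
    using assms(8) that by (simp add: saturated_dRW_def)
  have univ_S: "bij_betw (\<lambda>h. compose (carrier S) (mod_V_map p B h) \<beta>)
      (da_mor WS B) (ring_homs S (mod_V p B))"
    if "strict_dieudonne_algebra p B" for B :: "'u dieudonne_alg"
    using assms(9) that by (simp add: saturated_dRW_def)
  have f_bij: "bij_betw (\<lambda>g. compose (carrier R) g f) (ring_homs S (mod_V p B)) (ring_homs R (mod_V p B))"
    if "saturated_dieudonne_algebra p B" for B :: "'u dieudonne_alg"
    by (rule bij_betw_precompose_mod_V[OF that assms(1,4,5,6,7)])
  note f_closed = ring_hom_closed[OF assms(4)]

  define \<rho> where "\<rho> = saturated_dRW_map p R WR \<alpha> WS \<beta> f"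
  have "compose (carrier R) \<beta> f \<in> ring_homs R (mod_V p WS)"
    by (rule compose_in_ring_homs[OF R \<beta> assms(4)])
  then have ex1: "\<exists>!h. h \<in> da_mor WR WS \<and>
      compose (carrier R) (mod_V_map p WS h) \<alpha> = compose (carrier R) \<beta> f"
    by (rule bij_betw_ex1[OF univ_R[OF WS]])
  have compatible: "(\<forall>x\<in>carrier R. mod_V_map p WS h (\<alpha> x) = \<beta> (f x)) \<longleftrightarrow>
      compose (carrier R) (mod_V_map p WS h) \<alpha> = compose (carrier R) \<beta> f" for h
    by (auto simp: compose_def fun_eq_iff restrict_def)
  have "\<rho> \<in> da_mor WR WS \<and> compose (carrier R) (mod_V_map p WS \<rho>) \<alpha> = compose (carrier R) \<beta> f"
    unfolding \<rho>_def saturated_dRW_map_def compatible by (rule theI'[OF ex1])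
  then have \<rho>: "\<rho> \<in> da_mor WR WS" and \<rho>_eq: "\<And>x. x \<in> carrier R \<Longrightarrow> mod_V_map p WS \<rho> (\<alpha> x) = \<beta> (f x)"
    using compatible by blast+

  \<comment> \<open>The homomorphism \<open>\<alpha>\<close> extends along \<open>f\<close> to some \<open>\<gamma>\<close>, which the universal property of \<open>WS\<close>
    turns into the inverse \<open>\<sigma>\<close> of \<open>\<rho>\<close>.\<close>
  have "restrict \<alpha> (carrier R) \<in> ring_homs R (mod_V p WR)"
    using ring.ring_hom_restrict[OF R \<alpha>, of "restrict \<alpha> (carrier R)"] by (simp add: ring_homs_def)
  then obtain \<gamma> where \<gamma>: "\<gamma> \<in> ring_homs S (mod_V p WR)"
    and "compose (carrier R) \<gamma> f = restrict \<alpha> (carrier R)"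
    using bij_betw_ex1[OF f_bij[OF sat(1)]] by blast
  then have \<gamma>_eq: "\<gamma> (f x) = \<alpha> x" if "x \<in> carrier R" for x
    using that by (auto simp: compose_def fun_eq_iff restrict_def split: if_splits)
  obtain \<sigma> where \<sigma>: "\<sigma> \<in> da_mor WS WR"
    and "compose (carrier S) (mod_V_map p WR \<sigma>) \<beta> = \<gamma>"
    using bij_betw_ex1[OF univ_S[OF WR] \<gamma>] by blast
  then have \<sigma>_eq: "mod_V_map p WR \<sigma> (\<beta> y) = \<gamma> y" if "y \<in> carrier S" for y
    using that by (auto simp: compose_eq)

  have "da_comp WR \<sigma> \<rho> = da_id WR"
  proof (rule inj_onD[OF bij_betw_imp_inj_on[OF univ_R[OF WR]]])
    show "compose (carrier R) (mod_V_map p WR (da_comp WR \<sigma> \<rho>)) \<alpha> =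
        compose (carrier R) (mod_V_map p WR (da_id WR)) \<alpha>"
      by (rule extensionalityI[of _ "carrier R"])
        (simp_all add: compose_eq ring_hom_closed[OF \<alpha>] mod_V_map_id sat \<rho>_eq \<sigma>_eq \<gamma>_eq f_closed
          mod_V_map_comp[OF sat(1,2,1) \<rho> \<sigma>])
  qed (use \<rho> \<sigma> WR.da_comp_in_da_mor WR.da_id_in_da_mor in auto)
  moreover have "da_comp WS \<rho> \<sigma> = da_id WS"
  proof (rule inj_onD[OF bij_betw_imp_inj_on[OF univ_S[OF WS]]])
    show mor: "da_comp WS \<rho> \<sigma> \<in> da_mor WS WS" "da_id WS \<in> da_mor WS WS"
      using \<rho> \<sigma> WS.da_comp_in_da_mor WS.da_id_in_da_mor by auto
    show "compose (carrier S) (mod_V_map p WS (da_comp WS \<rho> \<sigma>)) \<beta> =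
        compose (carrier S) (mod_V_map p WS (da_id WS)) \<beta>"
    \<comment> \<open>Homomorphisms from \<open>S\<close> to \<open>mod_V p WS\<close> are equal once they agree on the image of \<open>f\<close>.\<close>
    proof (rule inj_onD[OF bij_betw_imp_inj_on[OF f_bij[OF sat(2)]]])
      show "compose (carrier R) (compose (carrier S) (mod_V_map p WS (da_comp WS \<rho> \<sigma>)) \<beta>) f =
          compose (carrier R) (compose (carrier S) (mod_V_map p WS (da_id WS)) \<beta>) f"
        by (rule extensionalityI[of _ "carrier R"])
          (simp_all add: compose_eq ring_hom_closed[OF \<beta>] mod_V_map_id sat \<rho>_eq \<sigma>_eq \<gamma>_eq f_closed
            mod_V_map_comp[OF sat(2,1,2) \<sigma> \<rho>])
    qed (use mor bij_betwE[OF univ_S[OF WS]] in auto)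
  qed
  ultimately have "\<forall>n. (\<forall>x\<in>carrier (gr WR n). \<sigma> n (\<rho> n x) = x) \<and> (\<forall>y\<in>carrier (gr WS n). \<rho> n (\<sigma> n y) = y)"
    by (auto simp: da_comp_def da_id_def compose_def fun_eq_iff restrict_def) metis+
  then show ?thesis
    using \<rho> \<sigma> unfolding da_iso_def \<rho>_def by blast
qed

end
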